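(* Let $\{\mathcal G_i : i\in I\}$ be a family of ultrafilters on $\mathbb N$, let $\mathcal H$ be an ultrafilter on $I$, and let $\mathcal F=\lim_{i\to\mathcal H}\mathcal G_i$. Then for every basic class $\mathcal P^u\in\mathcal B$, $$\alpha_{\mathcal F}(\mathcal P^u)=\min_{A\in\mathcal P^u\cap\mathcal C}\ \mathcal H\text{-}\lim_{i}\ \sum_{\mathcal Q^v\in\overline{A}}\alpha_{\mathcal G_i}(\mathcal Q^v).$$
   Context: Divisibility of ultrafilters. $\mathbb N=\{1,2,3,\dots\}$, $\mathbb P$ is the set of primes, $\beta\mathbb N$ is the set of ultrafilters on $\mathbb N$, with $n\in\mathbb N$ identified with the principal ultrafilter at $n$. For $A\subseteq\mathbb N$ let $A\uparrow=\{n\in\mathbb N:(\exists a\in A)\,a\mid n\}$, and $\mathcal U=\{A\subseteq\mathbb N: A\ne\emptyset,\ A=A\uparrow\}$. For $\mathcal F,\mathcal G\in\beta\mathbb N$: $\mathcal F\,\widetilde{\mid}\,\mathcal G$ iff $\mathcal F\cap\mathcal U\subseteq\mathcal G$; $\mathcal F=_\sim\mathcal G$ iff $\mathcal F\,\widetilde{\mid}\,\mathcal G$ and $\mathcal G\,\widetilde{\mid}\,\mathcal F$. Nonstandard extension. Standing assumption: we work in a fixed nonstandard extension ${}^*$ (of a superstructure over $\mathbb N$) which is $\mathfrak c^+$-saturated and satisfies Henson's isomorphism property (any two elementarily equivalent internally presented structures, for a finite first-order language, are isomorphic). In particular all sets $[1,z]=\{a\in{}^*\mathbb N:a\le z\}$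 with $z\in{}^*\mathbb N\setminus\mathbb N$ have the same cardinality, denoted $\infty$. For $x\in{}^*\mathbb N$, $tp(x/\mathbb N)=\{A\subseteq\mathbb N:x\in{}^*A\}\in\beta\mathbb N$; $x\models\mathcal F$ ($x$ is a generator of $\mathcal F$) means $tp(x/\mathbb N)=\mathcal F$. ${}^*\!\mid$ is the extension of divisibility to ${}^*\mathbb N$. Basic classes. $\overline{\mathbb P}=\{\mathcal P\in\beta\mathbb N:\mathbb P\in\mathcal P\}$. For $\mathcal P\in\overline{\mathbb P}$, on pairs $(p,a)$ with $p\models\mathcal P$, $a\in{}^*\mathbb N$, put $(p,a)\approx_{\mathcal P}(q,b)$ iff $tp(p^a/\mathbb N)=_\sim tp(q^b/\mathbb N)$; $\mathcal E_{\mathcal P}$ is the set of $\approx_{\mathcal P}$-classes. For $u\in\mathcal E_{\mathcal P}$ the set $\mathcal P^u=\{tp(p^a/\mathbb N):(p,a)\in u\}$ is called a basic class, and $\mathcal B$ is the set of all basic classes. $p^a\models\mathcal P^u$ means $(p,a)\in u$. For $A\subseteq\mathbb N$, $A\in\mathcal P^u$ means $A\in\mathcal F$ for all $\mathcal F\in\mathcal P^u$. For a standard prime $p$ the basic classes are $p^k$ ($k\in\mathbb N$) and a single further one, $p^\omega$ (generated by $p^a$ with $a$ infinite). Patterns. $\mathbb N_\infty=\{0,1,2,\dots\}\cup\{\infty\}$ with its natural order and the topology of the one-point compactification of the discrete space $\{0,1,2,\dots\}$. For $x\in{}^*\mathbb N$, $p\in{}^*\mathbb P$, $a\in{}^*\mathbb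 N$, $p^a\,{}^*\!\!\parallel x$ ($p^a$ is an exact divisor of $x$) means $x=p^ax'$ with $p$ not dividing $x'$. The pattern of $x$ is $\alpha_x:\mathcal B\to\mathbb N_\infty$, $\alpha_x(\mathcal P^u)=|\{(p,a):p^a\models\mathcal P^u,\ p^a\,{}^*\!\!\parallel x\}|$ (this cardinality is known to lie in $\mathbb N_\infty$). For $\mathcal F\in\beta\mathbb N$, $\alpha_{\mathcal F}:=\alpha_x$ for any $x\models\mathcal F$ (known to be independent of $x$). Convex sets. $\mathbb P^{exp}=\{p^n:p\in\mathbb P,n\in\mathbb N\}$. $A\subseteq\mathbb N$ is convex if $a,b\in A$, $a\mid c$, $c\mid b$ imply $c\in A$. $\mathcal C$ is the family of nonempty convex subsets of $\mathbb P^{exp}$; $\mathcal P^u\cap\mathcal C=\{A\in\mathcal C:A\in\mathcal P^u\}$. For $A\in\mathcal C$, $\overline A=\{\mathcal Q^v\in\mathcal B:A\in\mathcal Q^v\}$. Sums are sums of cardinals; for patterns of ultrafilters the sums $\sum_{\mathcal Q^v\in\overline A}\alpha_{\mathcal G}(\mathcal Q^v)$, $A\in\mathcal C$, lie in $\mathbb N_\infty$. Limits. $\lim_{i\to\mathcal H}\mathcal G_i$ is the ultrafilter with $A\in\lim_{i\to\mathcal H}\mathcal G_i$ iff $\{i\in I:A\in\mathcal G_i\}\in\mathcal H$. For $x_i,y\in\mathbb N_\infty$, $\mathcal H\text{-}\lim x_i=y$ means that $\{i\in I:x_i\in D\}\in\mathcal H$ for every neighborhood $D$ of $y$. *)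

theory Defs
  imports
    "HOL-Library.Equipollence"
    "HOL-Library.Extended_Real"
    "HOL-Computational_Algebra.Primes"
begin

section \<open>Superstructures\<close>

text \<open>
  A set-theoretic universe with atoms is carried by a whole type: the record consists of the set of
  atoms and the membership relation (\<open>elt U y s\<close> means that \<open>y\<close> is an element of \<open>s\<close>).
\<close>

record 'a universe =
  atoms :: "'a set"
  elt :: "'a \<Rightarrow> 'a \<Rightarrow> bool"

definition is_set :: "('a, 'm) universe_scheme \<Rightarrow> 'a \<Rightarrow> 'a set \<Rightarrow> bool" where
  "is_set U s S \<longleftrightarrow> s \<notin> atoms U \<and> (\<forall>y. elt U y s \<longleftrightarrow> y \<in> S)"

primrec level :: "('a, 'm) universe_scheme \<Rightarrow> nat \<Rightarrow> 'a set" where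
  "level U 0 = atoms U"
| "level U (Suc n) = level U n \<union> {s. s \<notin> atoms U \<and> (\<forall>y. elt U y s \<longrightarrow> y \<in> level U n)}"

text \<open>
  \<open>superstructure h U\<close>: up to isomorphism, \<open>U\<close> is the union of the levels \<open>V\<^sub>n(X)\<close>, \<open>n \<le> h\<close>, of the
  cumulative hierarchy over its set \<open>X\<close> of atoms, where \<open>V\<^sub>0(X) = X\<close> and
  \<open>V\<^sub>n\<^sub>+\<^sub>1(X) = V\<^sub>n(X) \<union> Pow (V\<^sub>n(X))\<close>. The superstructure in the usual sense is the case \<open>h = \<infinity>\<close>.
  Finite heights are admitted as well, because HOL does not prove that there is a type large enough
  to carry all the levels \<open>V\<^sub>n(X)\<close>, \<open>n < \<omega>\<close>, at once. Ternary relations on \<open>X\<close> are elements of \<open>V\<^sub>5(X)\<close>.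
\<close>

definition superstructure :: "enat \<Rightarrow> ('a, 'm) universe_scheme \<Rightarrow> bool" where
  "superstructure h U \<longleftrightarrow>
     (\<forall>x\<in>atoms U. \<forall>y. \<not> elt U y x) \<and>
     (\<forall>s t. s \<notin> atoms U \<and> t \<notin> atoms U \<and> (\<forall>y. elt U y s \<longleftrightarrow> elt U y t) \<longrightarrow> s = t) \<and>
     (\<forall>v. \<exists>n. enat n \<le> h \<and> v \<in> level U n) \<and>
     (\<forall>n S. enat n < h \<and> S \<subseteq> level U n \<longrightarrow> (\<exists>s. is_set U s S))"

text \<open>
  Kuratowski pairs and tuples; a tuple of length one is its entry. These are relations rather than
  functions since in a universe of finite height not all pairs exist.
\<close>

definition is_pair :: "('a, 'm) universe_scheme \<Rightarrow> 'a \<Rightarrow> 'a \<Rightarrow> 'a \<Rightarrow> bool" where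
  "is_pair U x y p \<longleftrightarrow> (\<exists>s t. is_set U s {x} \<and> is_set U t {x, y} \<and> is_set U p {s, t})"

fun is_tuple :: "('a, 'm) universe_scheme \<Rightarrow> 'a list \<Rightarrow> 'a \<Rightarrow> bool" where
  "is_tuple U [] t \<longleftrightarrow> is_set U t {}"
| "is_tuple U [x] t \<longleftrightarrow> t = x"
| "is_tuple U (x # y # zs) t \<longleftrightarrow> (\<exists>s. is_tuple U (y # zs) s \<and> is_pair U x s t)"


section \<open>Bounded formulas and transfer\<close>

text \<open>\<open>BAll i j \<phi>\<close> is the bounded quantification \<open>\<forall>x\<^sub>i\<in>x\<^sub>j. \<phi>\<close>.\<close>

datatype bfm =
    BEq nat nat
  | BMem nat nat
  | BNeg bfm
  | BConj bfm bfm
  | BAll nat nat bfm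

primrec bsat :: "('a, 'm) universe_scheme \<Rightarrow> (nat \<Rightarrow> 'a) \<Rightarrow> bfm \<Rightarrow> bool" where
  "bsat U e (BEq i j) \<longleftrightarrow> e i = e j"
| "bsat U e (BMem i j) \<longleftrightarrow> elt U (e i) (e j)"
| "bsat U e (BNeg \<phi>) \<longleftrightarrow> \<not> bsat U e \<phi>"
| "bsat U e (BConj \<phi> \<psi>) \<longleftrightarrow> bsat U e \<phi> \<and> bsat U e \<psi>"
| "bsat U e (BAll i j \<phi>) \<longleftrightarrow> (\<forall>y. elt U y (e j) \<longrightarrow> bsat U (e(i := y)) \<phi>)"

text \<open>
  The data of a nonstandard extension: \<open>star ext\<close> maps the standard universe \<open>std ext\<close>, whose atoms are
  the numbers \<open>1, 2, 3, \<dots>\<close> embedded by \<open>num ext\<close>, to the universe \<open>nst ext\<close>.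
\<close>

record ('v, 'w) nsext =
  num :: "nat \<Rightarrow> 'v"
  std :: "'v universe"
  nst :: "'w universe"
  star :: "'v \<Rightarrow> 'w"

definition internal :: "('v, 'w) nsext \<Rightarrow> 'w \<Rightarrow> bool" where
  "internal ext w \<longleftrightarrow> (\<exists>v. elt (nst ext) w (star ext v))"

definition transfer :: "('v, 'w) nsext \<Rightarrow> bool" where
  "transfer ext \<longleftrightarrow> (\<forall>\<phi> e. bsat (std ext) e \<phi> \<longleftrightarrow> bsat (nst ext) (\<lambda>i. star ext (e i)) \<phi>)"

text \<open>\<open>\<cc>\<^sup>+\<close>-saturation concerns families of fewer than \<open>\<cc>\<^sup>+\<close>, i.e. of at most \<open>\<cc>\<close>, internal sets.\<close>

definition saturated :: "('v, 'w) nsext \<Rightarrow> bool" where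
  "saturated ext \<longleftrightarrow>
     (\<forall>\<A>. (\<forall>s\<in>\<A>. internal ext s) \<and> \<A> \<lesssim> (UNIV :: nat set set) \<and>
          (\<forall>\<D>. finite \<D> \<and> \<D> \<subseteq> \<A> \<longrightarrow> (\<exists>x. \<forall>s\<in>\<D>. elt (nst ext) x s))
        \<longrightarrow> (\<exists>x. \<forall>s\<in>\<A>. elt (nst ext) x s))"


section \<open>Henson's isomorphism property\<close>

text \<open>
  A finite first-order language is given by the lists \<open>rs\<close> and \<open>fs\<close> of the arities of its relation
  and function symbols; the symbols are the positions in these lists.
\<close>

datatype trm = Var nat | Fn nat "trm list"

datatype fm =
    Eql trm trm
  | Rel nat "trm list"
  | Neg fm
  | Conj fm fm
  | All nat fm

primrec wf_trm :: "nat list \<Rightarrow> trm \<Rightarrow> bool" where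
  "wf_trm fs (Var i) \<longleftrightarrow> True"
| "wf_trm fs (Fn j ts) \<longleftrightarrow> j < length fs \<and> length ts = fs ! j \<and> list_all (wf_trm fs) ts"

primrec wf_fm :: "nat list \<Rightarrow> nat list \<Rightarrow> fm \<Rightarrow> bool" where
  "wf_fm rs fs (Eql s t) \<longleftrightarrow> wf_trm fs s \<and> wf_trm fs t"
| "wf_fm rs fs (Rel i ts) \<longleftrightarrow> i < length rs \<and> length ts = rs ! i \<and> list_all (wf_trm fs) ts"
| "wf_fm rs fs (Neg \<phi>) \<longleftrightarrow> wf_fm rs fs \<phi>"
| "wf_fm rs fs (Conj \<phi> \<psi>) \<longleftrightarrow> wf_fm rs fs \<phi> \<and> wf_fm rs fs \<psi>"
| "wf_fm rs fs (All i \<phi>) \<longleftrightarrow> wf_fm rs fs \<phi>"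

primrec vars_trm :: "trm \<Rightarrow> nat set" where
  "vars_trm (Var i) = {i}"
| "vars_trm (Fn j ts) = \<Union>(set (map vars_trm ts))"

primrec free_vars :: "fm \<Rightarrow> nat set" where
  "free_vars (Eql s t) = vars_trm s \<union> vars_trm t"
| "free_vars (Rel i ts) = \<Union>(set (map vars_trm ts))"
| "free_vars (Neg \<phi>) = free_vars \<phi>"
| "free_vars (Conj \<phi> \<psi>) = free_vars \<phi> \<union> free_vars \<psi>"
| "free_vars (All i \<phi>) = free_vars \<phi> - {i}"

record 'a fo_structure =
  dom :: "'a set"
  rels :: "nat \<Rightarrow> 'a list set"
  funs :: "nat \<Rightarrow> 'a list \<Rightarrow> 'a"

primrec val :: "('a, 'm) fo_structure_scheme \<Rightarrow> (nat \<Rightarrow> 'a) \<Rightarrow> trm \<Rightarrow> 'a" where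
  "val M e (Var i) = e i"
| "val M e (Fn j ts) = funs M j (map (val M e) ts)"

primrec sat :: "('a, 'm) fo_structure_scheme \<Rightarrow> (nat \<Rightarrow> 'a) \<Rightarrow> fm \<Rightarrow> bool" where
  "sat M e (Eql s t) \<longleftrightarrow> val M e s = val M e t"
| "sat M e (Rel i ts) \<longleftrightarrow> map (val M e) ts \<in> rels M i"
| "sat M e (Neg \<phi>) \<longleftrightarrow> \<not> sat M e \<phi>"
| "sat M e (Conj \<phi> \<psi>) \<longleftrightarrow> sat M e \<phi> \<and> sat M e \<psi>"
| "sat M e (All i \<phi>) \<longleftrightarrow> (\<forall>d\<in>dom M. sat M (e(i := d)) \<phi>)"

definition holds :: "('a, 'm) fo_structure_scheme \<Rightarrow> fm \<Rightarrow> bool" where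
  "holds M \<phi> \<longleftrightarrow> (\<forall>e. range e \<subseteq> dom M \<longrightarrow> sat M e \<phi>)"

definition elementarily_equivalent ::
    "nat list \<Rightarrow> nat list \<Rightarrow> ('a, 'm) fo_structure_scheme \<Rightarrow> ('a, 'm) fo_structure_scheme \<Rightarrow> bool" where
  "elementarily_equivalent rs fs M M' \<longleftrightarrow>
     (\<forall>\<phi>. wf_fm rs fs \<phi> \<and> free_vars \<phi> = {} \<longrightarrow> (holds M \<phi> \<longleftrightarrow> holds M' \<phi>))"

definition args :: "('a, 'm) fo_structure_scheme \<Rightarrow> nat \<Rightarrow> 'a list set" where
  "args M k = {xs. length xs = k \<and> set xs \<subseteq> dom M}"

definition isomorphic ::
    "nat list \<Rightarrow> nat list \<Rightarrow> ('a, 'm) fo_structure_scheme \<Rightarrow> ('a, 'm) fo_structure_scheme \<Rightarrow> bool" where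
  "isomorphic rs fs M M' \<longleftrightarrow>
     (\<exists>f. bij_betw f (dom M) (dom M') \<and>
          (\<forall>i<length rs. \<forall>xs\<in>args M (rs ! i). xs \<in> rels M i \<longleftrightarrow> map f xs \<in> rels M' i) \<and>
          (\<forall>j<length fs. \<forall>xs\<in>args M (fs ! j). f (funs M j xs) = funs M' j (map f xs)))"

definition internally_presented ::
    "('v, 'w) nsext \<Rightarrow> nat list \<Rightarrow> nat list \<Rightarrow> 'w fo_structure \<Rightarrow> bool" where
  "internally_presented ext rs fs M \<longleftrightarrow>
     dom M \<noteq> {} \<and>
     (\<exists>D. internal ext D \<and> is_set (nst ext) D (dom M)) \<and>
     (\<forall>i<length rs. \<exists>R. internal ext R \<and>
        rels M i = {xs \<in> args M (rs ! i). \<exists>t. is_tuple (nst ext) xs t \<and> elt (nst ext) t R}) \<and>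
     (\<forall>j<length fs. \<exists>R. internal ext R \<and>
        (\<forall>xs\<in>args M (fs ! j). funs M j xs \<in> dom M \<and>
           (\<forall>y\<in>dom M. (\<exists>t. is_tuple (nst ext) (xs @ [y]) t \<and> elt (nst ext) t R) \<longleftrightarrow> y = funs M j xs)))"

definition isomorphism_property :: "('v, 'w) nsext \<Rightarrow> bool" where
  "isomorphism_property ext \<longleftrightarrow>
     (\<forall>rs fs M M'. internally_presented ext rs fs M \<and> internally_presented ext rs fs M' \<and>
        elementarily_equivalent rs fs M M' \<longrightarrow> isomorphic rs fs M M')"


section \<open>The nonstandard extension\<close>

text \<open>Membership of a tuple of nonstandard objects in the extension of a relation on \<open>1, 2, 3, \<dots>\<close>.\<close>

definition star_rel :: "('v, 'w) nsext \<Rightarrow> nat list set \<Rightarrow> 'w list \<Rightarrow> bool" where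
  "star_rel ext R xs \<longleftrightarrow>
     (\<exists>r t. is_set (std ext) r {s. \<exists>ns\<in>R. is_tuple (std ext) (map (num ext) ns) s} \<and>
            is_tuple (nst ext) xs t \<and> elt (nst ext) t (star ext r))"

definition star_set :: "('v, 'w) nsext \<Rightarrow> nat set \<Rightarrow> 'w set" where
  "star_set ext A = {x. star_rel ext {[n] |n. n \<in> A} [x]}"

abbreviation star_nat :: "('v, 'w) nsext \<Rightarrow> 'w set" where
  "star_nat ext \<equiv> star_set ext {1..}"

definition nonstandard_extension :: "enat \<Rightarrow> ('v, 'w) nsext \<Rightarrow> bool" where
  "nonstandard_extension h ext \<longleftrightarrow>
     superstructure h (std ext) \<and> superstructure h (nst ext) \<and>
     inj_on (num ext) {1..} \<and> atoms (std ext) = num ext ` {1..} \<and>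
     atoms (nst ext) = star_nat ext \<and>
     transfer ext \<and> saturated ext \<and> isomorphism_property ext"

definition star_dvd :: "('v, 'w) nsext \<Rightarrow> 'w \<Rightarrow> 'w \<Rightarrow> bool" where
  "star_dvd ext x y \<longleftrightarrow> star_rel ext {[m, n] |m n. 1 \<le> m \<and> 1 \<le> n \<and> m dvd n} [x, y]"

definition star_le :: "('v, 'w) nsext \<Rightarrow> 'w \<Rightarrow> 'w \<Rightarrow> bool" where
  "star_le ext x y \<longleftrightarrow> star_rel ext {[m, n] |m n. 1 \<le> m \<and> 1 \<le> n \<and> m \<le> n} [x, y]"

definition star_times :: "('v, 'w) nsext \<Rightarrow> 'w \<Rightarrow> 'w \<Rightarrow> 'w" where
  "star_times ext x y = (THE z. star_rel ext {[m, n, m * n] |m n. 1 \<le> m \<and> 1 \<le> n} [x, y, z])"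

definition star_power :: "('v, 'w) nsext \<Rightarrow> 'w \<Rightarrow> 'w \<Rightarrow> 'w" where
  "star_power ext x y = (THE z. star_rel ext {[m, n, m ^ n] |m n. 1 \<le> m \<and> 1 \<le> n} [x, y, z])"

definition infinite_nats :: "('v, 'w) nsext \<Rightarrow> 'w set" where
  "infinite_nats ext = star_nat ext - (\<lambda>n. star ext (num ext n)) ` {1..}"

text \<open>
  The cardinals in \<open>\<nat>\<^sub>\<infinity>\<close> are represented by type \<open>enat\<close>, with \<open>\<infinity>\<close> standing for the common cardinality
  of the sets \<open>[1, z]\<close>, \<open>z\<close> infinite; a set of any other infinite cardinality has no cardinal in \<open>\<nat>\<^sub>\<infinity>\<close>.
\<close>

definition has_card :: "('v, 'w) nsext \<Rightarrow> 'a set \<Rightarrow> enat \<Rightarrow> bool" where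
  "has_card ext S k = (case k of
       enat n \<Rightarrow> finite S \<and> card S = n
     | \<infinity> \<Rightarrow> (\<exists>z\<in>infinite_nats ext. S \<approx> {a \<in> star_nat ext. star_le ext a z}))"

definition cardinal :: "('v, 'w) nsext \<Rightarrow> 'a set \<Rightarrow> enat" where
  "cardinal ext S = (THE k. has_card ext S k)"

text \<open>The sum of the cardinals \<open>f b\<close>, \<open>b \<in> S\<close>: the cardinality of a disjoint union of sets of these sizes.\<close>

definition cardinal_sum :: "('v, 'w) nsext \<Rightarrow> 'b set \<Rightarrow> ('b \<Rightarrow> enat) \<Rightarrow> enat" where
  "cardinal_sum ext S f =
     (THE k. \<forall>X :: 'b \<Rightarrow> 'w set. (\<forall>b\<in>S. has_card ext (X b) (f b)) \<longrightarrow> has_card ext (Sigma S X) k)"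


section \<open>Ultrafilters and divisibility\<close>

definition ultrafilter_on :: "'a set \<Rightarrow> 'a set set \<Rightarrow> bool" where
  "ultrafilter_on S \<F> \<longleftrightarrow>
     \<F> \<subseteq> Pow S \<and> S \<in> \<F> \<and> {} \<notin> \<F> \<and>
     (\<forall>A\<in>\<F>. \<forall>B\<in>\<F>. A \<inter> B \<in> \<F>) \<and>
     (\<forall>A\<in>\<F>. \<forall>B. A \<subseteq> B \<and> B \<subseteq> S \<longrightarrow> B \<in> \<F>) \<and>
     (\<forall>A. A \<subseteq> S \<longrightarrow> A \<in> \<F> \<or> S - A \<in> \<F>)"

definition beta_nat :: "nat set set set" where
  "beta_nat = {\<F>. ultrafilter_on {1..} \<F>}"

definition uf_lim :: "'i set \<Rightarrow> 'i set set \<Rightarrow> ('i \<Rightarrow> nat set set) \<Rightarrow> nat set set" where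
  "uf_lim I \<H> \<G> = {A. A \<subseteq> {1..} \<and> {i \<in> I. A \<in> \<G> i} \<in> \<H>}"

text \<open>The order topology of \<open>enat\<close> is that of the one-point compactification.\<close>

definition has_Hlim :: "'i set \<Rightarrow> 'i set set \<Rightarrow> ('i \<Rightarrow> enat) \<Rightarrow> enat \<Rightarrow> bool" where
  "has_Hlim I \<H> x y \<longleftrightarrow> (\<forall>D. open D \<and> y \<in> D \<longrightarrow> {i \<in> I. x i \<in> D} \<in> \<H>)"

definition Hlim :: "'i set \<Rightarrow> 'i set set \<Rightarrow> ('i \<Rightarrow> enat) \<Rightarrow> enat" where
  "Hlim I \<H> x = (THE y. has_Hlim I \<H> x y)"

definition up :: "nat set \<Rightarrow> nat set" where
  "up A = {n. 1 \<le> n \<and> (\<exists>a\<in>A. a dvd n)}"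

definition upward_sets :: "nat set set" where
  "upward_sets = {A. A \<subseteq> {1..} \<and> A \<noteq> {} \<and> A = up A}"

definition uf_dvd :: "nat set set \<Rightarrow> nat set set \<Rightarrow> bool" where
  "uf_dvd \<F> \<G> \<longleftrightarrow> \<F> \<inter> upward_sets \<subseteq> \<G>"

definition uf_sim :: "nat set set \<Rightarrow> nat set set \<Rightarrow> bool" where
  "uf_sim \<F> \<G> \<longleftrightarrow> uf_dvd \<F> \<G> \<and> uf_dvd \<G> \<F>"

definition tp :: "('v, 'w) nsext \<Rightarrow> 'w \<Rightarrow> nat set set" where
  "tp ext x = {A. A \<subseteq> {1..} \<and> x \<in> star_set ext A}"

definition generates :: "('v, 'w) nsext \<Rightarrow> 'w \<Rightarrow> nat set set \<Rightarrow> bool" where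
  "generates ext x \<F> \<longleftrightarrow> x \<in> star_nat ext \<and> tp ext x = \<F>"


section \<open>Basic classes and patterns\<close>

definition prime_ultrafilters :: "nat set set set" where
  "prime_ultrafilters = {\<P> \<in> beta_nat. {p. prime p} \<in> \<P>}"

definition power_pairs :: "('v, 'w) nsext \<Rightarrow> nat set set \<Rightarrow> ('w \<times> 'w) set" where
  "power_pairs ext \<P> = {(p, a). generates ext p \<P> \<and> a \<in> star_nat ext}"

definition approx_rel :: "('v, 'w) nsext \<Rightarrow> nat set set \<Rightarrow> (('w \<times> 'w) \<times> ('w \<times> 'w)) set" where
  "approx_rel ext \<P> =
     {((p, a), (q, b)). (p, a) \<in> power_pairs ext \<P> \<and> (q, b) \<in> power_pairs ext \<P> \<and>
        uf_sim (tp ext (star_power ext p a)) (tp ext (star_power ext q b))}"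

definition exponent_classes :: "('v, 'w) nsext \<Rightarrow> nat set set \<Rightarrow> ('w \<times> 'w) set set" where
  "exponent_classes ext \<P> = power_pairs ext \<P> // approx_rel ext \<P>"

definition basic_class :: "('v, 'w) nsext \<Rightarrow> ('w \<times> 'w) set \<Rightarrow> nat set set set" where
  "basic_class ext u = {tp ext (star_power ext p a) |p a. (p, a) \<in> u}"

definition basic_classes :: "('v, 'w) nsext \<Rightarrow> nat set set set set" where
  "basic_classes ext = {basic_class ext u |u \<P>. \<P> \<in> prime_ultrafilters \<and> u \<in> exponent_classes ext \<P>}"

text \<open>\<open>gen_basic ext p a B\<close> is \<open>p\<^sup>a \<Turnstile> B\<close>, i.e. \<open>(p, a) \<in> u\<close> where \<open>B = \<P>\<^sup>u\<close>.\<close>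

definition gen_basic :: "('v, 'w) nsext \<Rightarrow> 'w \<Rightarrow> 'w \<Rightarrow> nat set set set \<Rightarrow> bool" where
  "gen_basic ext p a B \<longleftrightarrow>
     (\<exists>\<P>\<in>prime_ultrafilters. \<exists>u\<in>exponent_classes ext \<P>. B = basic_class ext u \<and> (p, a) \<in> u)"

definition exact_divisor :: "('v, 'w) nsext \<Rightarrow> 'w \<Rightarrow> 'w \<Rightarrow> 'w \<Rightarrow> bool" where
  "exact_divisor ext p a x \<longleftrightarrow>
     p \<in> star_set ext {p. prime p} \<and> a \<in> star_nat ext \<and>
     (\<exists>x'\<in>star_nat ext. x = star_times ext (star_power ext p a) x' \<and> \<not> star_dvd ext p x')"

definition pattern :: "('v, 'w) nsext \<Rightarrow> 'w \<Rightarrow> nat set set set \<Rightarrow> enat" where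
  "pattern ext x B = cardinal ext {(p, a). gen_basic ext p a B \<and> exact_divisor ext p a x}"

text \<open>The value at \<open>B\<close> of \<open>\<alpha>\<^sub>x\<close> that is common to all generators \<open>x\<close> of \<open>\<F>\<close>.\<close>

definition uf_pattern :: "('v, 'w) nsext \<Rightarrow> nat set set \<Rightarrow> nat set set set \<Rightarrow> enat" where
  "uf_pattern ext \<F> B = (THE k. \<forall>x. generates ext x \<F> \<longrightarrow> pattern ext x B = k)"

definition in_class :: "nat set \<Rightarrow> nat set set set \<Rightarrow> bool" where
  "in_class A B \<longleftrightarrow> (\<forall>\<F>\<in>B. A \<in> \<F>)"

definition prime_powers :: "nat set" where
  "prime_powers = {p ^ n |p n. prime p \<and> 1 \<le> n}"

definition convex_set :: "nat set \<Rightarrow> bool" where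
  "convex_set A \<longleftrightarrow> (\<forall>a\<in>A. \<forall>b\<in>A. \<forall>c. a dvd c \<and> c dvd b \<longrightarrow> c \<in> A)"

definition convex_sets :: "nat set set" where
  "convex_sets = {A. A \<noteq> {} \<and> A \<subseteq> prime_powers \<and> convex_set A}"

definition closure_classes :: "('v, 'w) nsext \<Rightarrow> nat set \<Rightarrow> nat set set set set" where
  "closure_classes ext A = {B \<in> basic_classes ext. in_class A B}"

definition is_minimum :: "enat \<Rightarrow> enat set \<Rightarrow> bool" where
  "is_minimum m S \<longleftrightarrow> m \<in> S \<and> (\<forall>s\<in>S. m \<le> s)"

end

theory Submission
  imports Defs "HOL-Library.Nat_Bijection"
begin

text \<open>
  For \<open>x \<Turnstile> \<G>\<close> let \<open>Q\<^sub>x\<close> be the internal set of the exact prime power divisors of \<open>x\<close>. For a set \<open>A\<close> of prime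
  powers, whether \<open>Q\<^sub>x \<inter> *A\<close> has at least \<open>k\<close> elements depends only on whether the standard set of those \<open>n\<close>
  with at least \<open>k\<close> exact divisors in \<open>A\<close> belongs to \<open>\<G>\<close>. The cardinality of \<open>Q\<^sub>x \<inter> *A\<close> is thus a function
  \<open>s\<^sub>\<G>(A)\<close>, and it commutes with limits along \<open>\<H>\<close>.

  Basic classes are separated by convex sets: \<open>p\<^sup>a\<close> generates \<open>B\<close> iff \<open>p\<^sup>a \<in> *A\<close> for all convex \<open>A\<close> in \<open>B\<close>.
  Hence \<open>Q\<^sub>x \<inter> *A\<close> is the disjoint union of the sets that \<open>\<alpha>\<^sub>\<G>\<close> counts at the classes in the closure of \<open>A\<close>, and the
  sum of these values is \<open>s\<^sub>\<G>(A)\<close>. Moreover the set counted at \<open>B\<close> is the intersection of the directed family of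
  the internal sets \<open>Q\<^sub>x \<inter> *A\<close>, and saturation provides a hyperfinite subset of it that has as many elements as
  the smallest of them. So \<open>\<alpha>\<^sub>\<G>(B)\<close> is the minimum of \<open>s\<^sub>\<G>(A)\<close> over the convex \<open>A\<close> in \<open>B\<close>.
\<close>

text \<open>The obstacle is that a basic class cuts out an external set of exact divisors, about
  which transfer says nothing. Its cardinal comes from a squeeze between two internal sets: a finite
  minimum forces these to coincide, an infinite one makes them equipollent, and Schroeder-Bernstein
  applies. Henson's property serves to make \<infinity> one cardinal, because infinite initial
  segments are isomorphic as structures for the empty language; the rest works by transfer and
  saturation. The bound in saturation is met since all requirements can be indexed by sets of
  numbers. Cardinals are compared only through standard thresholds \<open>k\<close>, which determine
  an element of \<open>enat\<close>. Each threshold is a single standard set of numbers, so its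
  membership in an ultrafilter passes through limits by definition. Transfer is given for bounded
  formulas about sets. It is converted once into transfer for first-order formulas about numbers.
  There the height matters: a triple of atoms lies in level 6 and a set of triples in level 7,
  within the height 10 that is assumed.\<close>

section \<open>Sets, pairs and tuples in a superstructure\<close>

lemma superstructure_atom_no_elt:
  assumes "superstructure h U" "elt U y s"
  shows "s \<notin> atoms U"
  using assms(1)[unfolded superstructure_def, THEN conjunct1] assms(2) by blast

text \<open>Whatever has an element is not an atom. What remains of \<open>is_set\<close> can be
  written as a bounded formula.\<close>

lemma is_set_doubleton_iff:
  assumes "superstructure h U"
  shows "is_set U s {x, y} \<longleftrightarrow> elt U x s \<and> elt U y s \<and> (\<forall>z. elt U z s \<longrightarrow> z = x \<or> z = y)"
proof
  assume "elt U x s \<and> elt U y s \<and> (\<forall>z. elt U z s \<longrightarrow> z = x \<or> z = y)"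
  then show "is_set U s {x, y}"
    using superstructure_atom_no_elt[OF assms, of x s] by (auto simp: is_set_def)
qed (simp add: is_set_def)

lemma is_set_singleton_iff:
  assumes "superstructure h U"
  shows "is_set U s {x} \<longleftrightarrow> elt U x s \<and> (\<forall>y. elt U y s \<longrightarrow> y = x)"
  using is_set_doubleton_iff[OF assms, of s x x] by simp

lemma is_set_unique:
  assumes "superstructure h U" "is_set U s S" "is_set U t S"
  shows "s = t"
proof -
  have "\<forall>s t. s \<notin> atoms U \<and> t \<notin> atoms U \<and> (\<forall>y. elt U y s \<longleftrightarrow> elt U y t) \<longrightarrow> s = t"
    using assms(1)[unfolded superstructure_def] by simp
  then show ?thesis
    using assms(2,3) by (simp add: is_set_def)
qed

lemma is_pair_inject:
  assumes U: "superstructure h U" and p: "is_pair U x y p" "is_pair U x' y' p"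
  shows "x = x' \<and> y = y'"
proof -
  obtain s t where st: "is_set U s {x}" "is_set U t {x, y}" "is_set U p {s, t}"
    using p by (auto simp: is_pair_def)
  obtain s' t' where st': "is_set U s' {x'}" "is_set U t' {x', y'}" "is_set U p {s', t'}"
    using p by (auto simp: is_pair_def)
  have S: "\<And>u X Y. is_set U u X \<Longrightarrow> is_set U u Y \<Longrightarrow> X = Y"
    unfolding is_set_def by auto
  have eq: "{s, t} = {s', t'}"
    using S st(3) st'(3) by blast
  then have c: "s = s' \<and> t = t' \<or> s = t' \<and> t = s'"
    by (auto simp: doubleton_eq_iff)
  then show ?thesis
  proof
    assume "s = s' \<and> t = t'"
    then have "{x} = {x'}" "{x, y} = {x', y'}"
      using S st st' by blast+
    then show ?thesis by (auto simp: doubleton_eq_iff)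
  next
    assume "s = t' \<and> t = s'"
    then have "{x} = {x', y'}" "{x, y} = {x'}"
      using S st st' by blast+
    then show ?thesis by (auto simp: doubleton_eq_iff)
  qed
qed


text \<open>Equal lengths are assumed because a tuple with one entry is that entry, which may itself
  be a pair.\<close>

lemma is_tuple_inject:
  assumes "superstructure h U" "is_tuple U xs t" "is_tuple U ys t" "length xs = length ys"
  shows "xs = ys"
  using assms(2-)
proof (induction xs arbitrary: ys t)
  case Nil
  then show ?case by simp
next
  case (Cons x xs)
  then obtain y ys' where ys: "ys = y # ys'" and l: "length xs = length ys'"
    by (cases ys) auto
  show ?case
  proof (cases xs)
    case Nil
    then show ?thesis using Cons.prems ys l by auto
  next
    case c: (Cons x' xs')
    then obtain y' ys'' where c': "ys' = y' # ys''"
      using l by (cases ys') auto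
    obtain s s' where s: "is_tuple U xs s" "is_pair U x s t" "is_tuple U ys' s'" "is_pair U y s' t"
      using Cons.prems c c' ys by auto
    have "x = y" "s = s'"
      using is_pair_inject[OF assms(1) s(2,4)] by auto
    then show ?thesis
      using Cons.IH s l ys by metis
  qed
qed

lemma superstructure_set_exists:
  assumes "superstructure h U" "enat n < h" "S \<subseteq> level U n"
  shows "\<exists>s \<in> level U (Suc n). is_set U s S"
proof -
  obtain s where "is_set U s S"
    using assms(1)[unfolded superstructure_def] assms(2,3) by (elim conjE) metis
  moreover from this have "s \<in> level U (Suc n)"
    using assms(3) by (auto simp: is_set_def)
  ultimately show ?thesis by blast
qed

lemma is_pair_exists:
  assumes "superstructure h U" "enat (Suc n) < h" "x \<in> level U n" "y \<in> level U n"
  shows "\<exists>p \<in> level U (Suc (Suc n)). is_pair U x y p"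
proof -
  have n: "enat n < h"
    using assms(2) by (metis enat_ord_simps(2) lessI less_trans)
  obtain s t where "s \<in> level U (Suc n)" "is_set U s {x}" "t \<in> level U (Suc n)" "is_set U t {x, y}"
    using superstructure_set_exists[OF assms(1) n, of "{x}"]
      superstructure_set_exists[OF assms(1) n, of "{x, y}"] assms(3,4) by auto
  moreover obtain p where "p \<in> level U (Suc (Suc n))" "is_set U p {s, t}"
    using superstructure_set_exists[OF assms(1,2), of "{s, t}"] calculation by auto
  ultimately show ?thesis
    by (auto simp: is_pair_def)
qed

section \<open>First-order transfer\<close>

abbreviation BEx :: "nat \<Rightarrow> nat \<Rightarrow> bfm \<Rightarrow> bfm" where
  "BEx i j \<phi> \<equiv> BNeg (BAll i j (BNeg \<phi>))"

definition BIff :: "bfm \<Rightarrow> bfm \<Rightarrow> bfm" where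
  "BIff \<phi> \<psi> = BConj (BNeg (BConj \<phi> (BNeg \<psi>))) (BNeg (BConj \<psi> (BNeg \<phi>)))"

lemma bsat_BIff [simp]: "bsat U e (BIff \<phi> \<psi>) \<longleftrightarrow> (bsat U e \<phi> \<longleftrightarrow> bsat U e \<psi>)"
  by (auto simp: BIff_def)

definition BDoubleton :: "nat \<Rightarrow> nat \<Rightarrow> nat \<Rightarrow> bfm" where
  "BDoubleton x y s = BConj (BConj (BMem x s) (BMem y s))
     (BAll 4 s (BNeg (BConj (BNeg (BEq 4 x)) (BNeg (BEq 4 y)))))"

lemma bsat_BDoubleton:
  assumes "superstructure h U" "4 \<notin> {x, y, s}"
  shows "bsat U e (BDoubleton x y s) \<longleftrightarrow> is_set U (e s) {e x, e y}"
  using assms(2) by (auto simp: BDoubleton_def is_set_doubleton_iff[OF assms(1)])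

text \<open>The singleton and the doubleton that witness a Kuratowski pair are elements of it, so
  quantifiers bounded by the pair reach them.\<close>

definition BPair :: "nat \<Rightarrow> nat \<Rightarrow> nat \<Rightarrow> bfm" where
  "BPair x y p = BEx 5 p (BEx 6 p (BConj (BConj (BDoubleton x x 5) (BDoubleton x y 6)) (BDoubleton 5 6 p)))"

lemma bsat_BPair:
  assumes U: "superstructure h U" and "{4, 5, 6} \<inter> {x, y, p} = {}"
  shows "bsat U e (BPair x y p) \<longleftrightarrow> is_pair U (e x) (e y) (e p)"
  using assms(2)
  by (auto simp: BPair_def bsat_BDoubleton[OF U] is_pair_def is_set_doubleton_iff[OF U]
        is_set_singleton_iff[OF U]) 

text \<open>Convention for bounded formulas: the variable 0 denotes the set of numbers, 1 to 7 are auxiliary, the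
  even indices from 8 on are the variables of a first-order formula, and the odd ones from 9 on its relations.\<close>

fun BTuple :: "nat list \<Rightarrow> nat \<Rightarrow> bfm" where
  "BTuple [a] t = BEq a t"
| "BTuple [a, b] t = BPair a b t"
| "BTuple [a, b, c] t = BEx 2 t (BEx 3 2 (BConj (BPair b c 3) (BPair a 3 t)))"
| "BTuple _ t = BEq t t"

lemma bsat_BTuple:
  assumes U: "superstructure h U" and "\<forall>i\<in>set is. 7 < i" and "length is \<in> {1, 2, 3}"
  shows "bsat U e (BTuple is 7) \<longleftrightarrow> is_tuple U (map e is) (e 7)"
proof -
  consider a where "is = [a]" | a b where "is = [a, b]" | a b c where "is = [a, b, c]"
    using assms(3) by (auto simp: length_Suc_conv numeral_eq_Suc)
  then show ?thesis
  proof cases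
    case 1
    then show ?thesis by auto
  next
    case 2
    then show ?thesis using assms(2) by (auto simp: bsat_BPair[OF U])
  next
    case 3
    \<comment> \<open>The inner pair of a triple sits two membership steps below the triple. This is
      why \<open>BTuple\<close> quantifies over an element of the triple and then over an element of
      that element.\<close>
    have "\<And>a s p. is_pair U a s p \<Longrightarrow> \<exists>t. elt U t p \<and> elt U s t"
      by (auto simp: is_pair_def is_set_def)
    then have "(\<exists>u. elt U u p \<and> (\<exists>s. is_pair U b s' s \<and> elt U s u \<and> is_pair U a s p)) \<longleftrightarrow>
        (\<exists>s. is_pair U b s' s \<and> is_pair U a s p)" for a b s' p
      by blast
    then show ?thesis using 3 assms(2) by (simp add: bsat_BPair[OF U])
  qed
qed

lemma bsat_BTuple_ex:
  assumes "superstructure h U" "\<forall>i\<in>set is. 7 < i" "length is \<in> {1, 2, 3}"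
  shows "bsat U e (BEx 7 r (BTuple is 7)) \<longleftrightarrow> (\<exists>t. is_tuple U (map e is) t \<and> elt U t (e r))"
proof -
  have "map (e(7 := y)) is = map e is" for y
    using assms(2) by auto
  then have "bsat U (e(7 := y)) (BTuple is 7) \<longleftrightarrow> is_tuple U (map e is) y" for y
    using bsat_BTuple[OF assms, of "e(7 := y)"] by (metis fun_upd_same)
  then show ?thesis by auto
qed

text \<open>First-order formulas over the positive numbers, with arbitrary standard relations of arity at most 3
  as atoms. The relations are cut down to positive arguments by \<open>rel1\<close>, \<open>rel2\<close>, \<open>rel3\<close>.\<close>

datatype form =
    P1 "nat \<Rightarrow> bool" nat
  | P2 "nat \<Rightarrow> nat \<Rightarrow> bool" nat nat
  | P3 "nat \<Rightarrow> nat \<Rightarrow> nat \<Rightarrow> bool" nat nat nat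
  | FEq nat nat
  | FNot form
  | FAnd form form
  | FAll nat form

definition FImp :: "form \<Rightarrow> form \<Rightarrow> form" where "FImp \<phi> \<psi> = FNot (FAnd \<phi> (FNot \<psi>))"
definition FOr :: "form \<Rightarrow> form \<Rightarrow> form" where "FOr \<phi> \<psi> = FNot (FAnd (FNot \<phi>) (FNot \<psi>))"
definition FIff :: "form \<Rightarrow> form \<Rightarrow> form" where "FIff \<phi> \<psi> = FAnd (FImp \<phi> \<psi>) (FImp \<psi> \<phi>)"
definition FEx :: "nat \<Rightarrow> form \<Rightarrow> form" where "FEx i \<phi> = FNot (FAll i (FNot \<phi>))"

definition rel1 :: "(nat \<Rightarrow> bool) \<Rightarrow> nat list set" where
  "rel1 P = {[k] |k. 1 \<le> k \<and> P k}"
definition rel2 :: "(nat \<Rightarrow> nat \<Rightarrow> bool) \<Rightarrow> nat list set" where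
  "rel2 P = {[k, m] |k m. 1 \<le> k \<and> 1 \<le> m \<and> P k m}"
definition rel3 :: "(nat \<Rightarrow> nat \<Rightarrow> nat \<Rightarrow> bool) \<Rightarrow> nat list set" where
  "rel3 P = {[k, m, n] |k m n. 1 \<le> k \<and> 1 \<le> m \<and> 1 \<le> n \<and> P k m n}"

text \<open>Domain and interpretation are parameters, so that one formula can be read over the
  numbers, over the atoms of the standard universe and over the nonstandard numbers.\<close>

primrec fsat :: "'a set \<Rightarrow> (nat list set \<Rightarrow> 'a list \<Rightarrow> bool) \<Rightarrow> (nat \<Rightarrow> 'a) \<Rightarrow> form \<Rightarrow> bool" where
  "fsat D \<rho> e (P1 P i) \<longleftrightarrow> \<rho> (rel1 P) [e i]"
| "fsat D \<rho> e (P2 P i j) \<longleftrightarrow> \<rho> (rel2 P) [e i, e j]"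
| "fsat D \<rho> e (P3 P i j k) \<longleftrightarrow> \<rho> (rel3 P) [e i, e j, e k]"
| "fsat D \<rho> e (FEq i j) \<longleftrightarrow> e i = e j"
| "fsat D \<rho> e (FNot \<phi>) \<longleftrightarrow> \<not> fsat D \<rho> e \<phi>"
| "fsat D \<rho> e (FAnd \<phi> \<psi>) \<longleftrightarrow> fsat D \<rho> e \<phi> \<and> fsat D \<rho> e \<psi>"
| "fsat D \<rho> e (FAll i \<phi>) \<longleftrightarrow> (\<forall>d\<in>D. fsat D \<rho> (e(i := d)) \<phi>)"

lemma fsat_derived [simp]:
  "fsat D \<rho> e (FImp \<phi> \<psi>) \<longleftrightarrow> (fsat D \<rho> e \<phi> \<longrightarrow> fsat D \<rho> e \<psi>)"
  "fsat D \<rho> e (FOr \<phi> \<psi>) \<longleftrightarrow> (fsat D \<rho> e \<phi> \<or> fsat D \<rho> e \<psi>)"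
  "fsat D \<rho> e (FIff \<phi> \<psi>) \<longleftrightarrow> (fsat D \<rho> e \<phi> \<longleftrightarrow> fsat D \<rho> e \<psi>)"
  "fsat D \<rho> e (FEx i \<phi>) \<longleftrightarrow> (\<exists>d\<in>D. fsat D \<rho> (e(i := d)) \<phi>)"
  by (auto simp: FImp_def FOr_def FIff_def FEx_def)

primrec frels :: "form \<Rightarrow> nat list set set" where
  "frels (P1 P i) = {rel1 P}"
| "frels (P2 P i j) = {rel2 P}"
| "frels (P3 P i j k) = {rel3 P}"
| "frels (FEq i j) = {}"
| "frels (FNot \<phi>) = frels \<phi>"
| "frels (FAnd \<phi> \<psi>) = frels \<phi> \<union> frels \<psi>"
| "frels (FAll i \<phi>) = frels \<phi>"

lemma finite_frels: "finite (frels \<phi>)"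
  by (induction \<phi>) auto

text \<open>Serves to pass from the numbers to the atoms that represent them. The bound 3 is the
  largest arity in a \<open>form\<close>.\<close>

lemma fsat_inj_image:
  assumes "inj_on f D" "range e \<subseteq> D"
    "\<And>R xs. R \<in> frels \<phi> \<Longrightarrow> set xs \<subseteq> D \<Longrightarrow> xs \<noteq> [] \<Longrightarrow> length xs \<le> 3 \<Longrightarrow> \<rho>' R (map f xs) \<longleftrightarrow> \<rho> R xs"
  shows "fsat D \<rho> e \<phi> \<longleftrightarrow> fsat (f ` D) \<rho>' (f \<circ> e) \<phi>"
  using assms(2-)
proof (induction \<phi> arbitrary: e)
  case (P1 P i)
  then show ?case using P1(2)[of _ "[e i]"] by auto
next
  case (P2 P i j)
  then show ?case using P2(2)[of _ "[e i, e j]"] by auto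
next
  case (P3 P i j k)
  then show ?case using P3(2)[of _ "[e i, e j, e k]"] by auto
next
  case (FEq i j)
  then have "e i \<in> D" "e j \<in> D" by auto
  then show ?case using assms(1) by (auto simp: inj_on_eq_iff)
next
  case (FNot \<phi>)
  then show ?case by auto
next
  case (FAnd \<phi> \<psi>)
  then show ?case by auto
next
  case (FAll i \<phi>)
  have "fsat D \<rho> (e(i := d)) \<phi> \<longleftrightarrow> fsat (f ` D) \<rho>' ((f \<circ> e)(i := f d)) \<phi>" if "d \<in> D" for d
  proof -
    have "range (e(i := d)) \<subseteq> D" using that FAll.prems by auto
    moreover have "f \<circ> e(i := d) = (f \<circ> e)(i := f d)" by auto
    ultimately show ?thesis using FAll.IH[of "e(i := d)"] FAll.prems(2) by (metis frels.simps(7))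
  qed
  then show ?case by (simp add: comp_def)
qed

primrec to_bfm :: "(nat list set \<Rightarrow> nat) \<Rightarrow> form \<Rightarrow> bfm" where
  "to_bfm c (P1 P i) = BEx 7 (2 * c (rel1 P) + 9) (BTuple [2 * i + 8] 7)"
| "to_bfm c (P2 P i j) = BEx 7 (2 * c (rel2 P) + 9) (BTuple [2 * i + 8, 2 * j + 8] 7)"
| "to_bfm c (P3 P i j k) = BEx 7 (2 * c (rel3 P) + 9) (BTuple [2 * i + 8, 2 * j + 8, 2 * k + 8] 7)"
| "to_bfm c (FEq i j) = BEq (2 * i + 8) (2 * j + 8)"
| "to_bfm c (FNot \<phi>) = BNeg (to_bfm c \<phi>)"
| "to_bfm c (FAnd \<phi> \<psi>) = BConj (to_bfm c \<phi>) (to_bfm c \<psi>)"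
| "to_bfm c (FAll i \<phi>) = BAll (2 * i + 8) 0 (to_bfm c \<phi>)"

lemma bsat_to_bfm:
  assumes U: "superstructure h U"
  shows "bsat U e (to_bfm c \<phi>) \<longleftrightarrow>
    fsat {y. elt U y (e 0)} (\<lambda>R xs. \<exists>t. is_tuple U xs t \<and> elt U t (e (2 * c R + 9))) (\<lambda>i. e (2 * i + 8)) \<phi>"
proof (induction \<phi> arbitrary: e)
  case (FAll i \<phi>)
  have *: "(\<lambda>j. (e(2 * i + 8 := y)) (2 * j + 8)) = (\<lambda>j. e (2 * j + 8))(i := y)" for y
    by auto
  have "2 * c R + 9 \<noteq> 2 * i + 8" for R by presburger
  then have "(\<lambda>R xs. \<exists>t. is_tuple U xs t \<and> elt U t ((e(2 * i + 8 := y)) (2 * c R + 9))) =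
      (\<lambda>R xs. \<exists>t. is_tuple U xs t \<and> elt U t (e (2 * c R + 9)))" for y
    by simp
  then have "bsat U (e(2 * i + 8 := y)) (to_bfm c \<phi>) \<longleftrightarrow>
      fsat {y. elt U y (e 0)} (\<lambda>R xs. \<exists>t. is_tuple U xs t \<and> elt U t (e (2 * c R + 9)))
        ((\<lambda>j. e (2 * j + 8))(i := y)) \<phi>" for y
    unfolding FAll * by simp
  then show ?case by simp
next
  case (P1 P i)
  show ?case
    using bsat_BTuple_ex[OF U, of "[2 * i + 8]"] unfolding to_bfm.simps fsat.simps by (simp del: is_tuple.simps BTuple.simps)
next
  case (P2 P i j)
  show ?case
    using bsat_BTuple_ex[OF U, of "[2 * i + 8, 2 * j + 8]"] unfolding to_bfm.simps fsat.simps
    by (simp del: is_tuple.simps BTuple.simps)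
next
  case (P3 P i j k)
  show ?case
    using bsat_BTuple_ex[OF U, of "[2 * i + 8, 2 * j + 8, 2 * k + 8]"]
    unfolding to_bfm.simps fsat.simps by (simp del: is_tuple.simps BTuple.simps)
next
  case (FNot \<phi>)
  then show ?case unfolding to_bfm.simps bsat.simps fsat.simps by blast
next
  case (FAnd \<phi> \<psi>)
  then show ?case unfolding to_bfm.simps bsat.simps fsat.simps by blast
next
  case (FEq i j)
  show ?case by simp
qed

lemma fsat_cong:
  assumes "\<And>R. R \<in> frels \<phi> \<Longrightarrow> \<rho> R = \<rho>' R"
  shows "fsat D \<rho> e \<phi> \<longleftrightarrow> fsat D \<rho>' e \<phi>"
  using assms by (induction \<phi> arbitrary: e) auto

lemma mem_rel [simp]:
  "[k] \<in> rel1 P \<longleftrightarrow> 1 \<le> k \<and> P k"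
  "[k, m] \<in> rel2 Q \<longleftrightarrow> 1 \<le> k \<and> 1 \<le> m \<and> Q k m"
  "[k, m, n] \<in> rel3 T \<longleftrightarrow> 1 \<le> k \<and> 1 \<le> m \<and> 1 \<le> n \<and> T k m n"
  by (auto simp: rel1_def rel2_def rel3_def)

text \<open>Length at most 3 keeps the coded tuples in level 6; positive entries make them tuples of
  atoms.\<close>

definition positive_rel :: "nat list set \<Rightarrow> bool" where
  "positive_rel R \<longleftrightarrow> (\<forall>ns\<in>R. ns \<noteq> [] \<and> length ns \<le> 3 \<and> set ns \<subseteq> {1..})"

lemma positive_rel [simp]: "positive_rel (rel1 P)" "positive_rel (rel2 Q)" "positive_rel (rel3 T)"
  by (auto simp: positive_rel_def rel1_def rel2_def rel3_def)

lemma frels_positive: "R \<in> frels \<phi> \<Longrightarrow> positive_rel R"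
  by (induction \<phi>) auto

section \<open>Levels and existence of tuples of atoms\<close>

lemma is_set_level:
  assumes "is_set U s S" "S \<subseteq> level U n"
  shows "s \<in> level U (Suc n)"
  using assms by (auto simp: is_set_def)

lemma is_pair_level:
  assumes "is_pair U x y p" "x \<in> level U n" "y \<in> level U n"
  shows "p \<in> level U (Suc (Suc n))"
proof -
  obtain s t where st: "is_set U s {x}" "is_set U t {x, y}" "is_set U p {s, t}"
    using assms(1) by (auto simp: is_pair_def)
  then have "{s, t} \<subseteq> level U (Suc n)"
    using is_set_level[OF st(1), of n] is_set_level[OF st(2), of n] assms(2,3) by simp
  then show ?thesis by (rule is_set_level[OF st(3)])
qed

lemma atoms_subset_level: "x \<in> atoms U \<Longrightarrow> x \<in> level U n"
  by (induction n) auto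

text \<open>Every Kuratowski pair lies two levels above its components.\<close>

lemma is_tuple_level:
  assumes "is_tuple U xs t" "set xs \<subseteq> atoms U" "xs \<noteq> []"
  shows "t \<in> level U (2 * length xs)"
  using assms
proof (induction xs arbitrary: t rule: induct_list012)
  case (2 x)
  then show ?case using atoms_subset_level[of x U 2] by simp
next
  case (3 x y zs)
  then obtain s where s: "is_tuple U (y # zs) s" "is_pair U x s t"
    by auto
  have "s \<in> level U (2 * length (y # zs))"
    using "3.IH"(2)[OF s(1)] "3.prems" by auto
  moreover have "x \<in> level U (2 * length (y # zs))"
    using atoms_subset_level[of x U] "3.prems"(2) by simp
  ultimately have "t \<in> level U (Suc (Suc (2 * length (y # zs))))"
    using is_pair_level[OF s(2)] by blast
  then show ?case by (simp only: list.size mult_Suc_right add_2_eq_Suc add_0_right One_nat_def add_Suc_right)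
qed simp

lemma is_tuple_exists:
  assumes U: "superstructure h U" and "set xs \<subseteq> atoms U" "xs \<noteq> []" "enat (2 * length xs) < h"
  shows "\<exists>t. is_tuple U xs t"
  using assms(2-)
proof (induction xs rule: induct_list012)
  case (3 x y zs)
  have "enat (2 * length (y # zs)) < h"
    using "3.prems"(3) by (rule order_le_less_trans[rotated]) simp
  then obtain s where s: "is_tuple U (y # zs) s"
    using 3 by auto
  have "s \<in> level U (2 * length (y # zs))"
    using is_tuple_level[OF s] "3.prems" by auto
  moreover have "enat (Suc (2 * length (y # zs))) < h"
    using "3.prems"(3) by (rule order_le_less_trans[rotated]) simp
  moreover have "x \<in> level U (2 * length (y # zs))"
    using atoms_subset_level "3.prems" by auto
  ultimately obtain t where "is_pair U x s t"
    using is_pair_exists[OF U] by blast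
  then show ?case using s by auto
qed auto

text \<open>A pair is never an atom, so with atoms as entries the length of a tuple can be read off
  and need not be given.\<close>

lemma is_tuple_inject_atoms:
  assumes U: "superstructure h U" and "is_tuple U xs t" "is_tuple U ys t"
    "set xs \<subseteq> atoms U" "set ys \<subseteq> atoms U" "xs \<noteq> []" "ys \<noteq> []"
  shows "xs = ys"
  using assms(2-)
proof (induction xs arbitrary: t ys rule: induct_list012)
  case (2 x)
  have "\<not> is_pair U y s t" for y s
    using 2 by (auto simp: is_pair_def is_set_def)
  then have "ys = [hd ys]"
    using 2 by (cases ys; cases "tl ys") auto
  then show ?case using 2 by (metis is_tuple.simps(2))
next
  case (3 x x' zs)
  have "t \<notin> atoms U"
    using 3(3) by (auto simp: is_pair_def is_set_def)
  then have "\<forall>y. ys \<noteq> [y]"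
    using 3 by auto
  then obtain y y' ws where ys: "ys = y # y' # ws"
    using 3 by (metis neq_Nil_conv)
  obtain s s' where s: "is_tuple U (x' # zs) s" "is_pair U x s t" "is_tuple U (y' # ws) s'" "is_pair U y s' t"
    using 3 ys by auto
  have "x = y" "s = s'"
    using is_pair_inject[OF U s(2,4)] by auto
  moreover have "x' # zs = y' # ws"
    using "3.IH"(2)[OF s(1)] s(3) \<open>s = s'\<close> "3.prems" ys by auto
  ultimately show ?case using ys by simp
qed simp

locale nonstandard =
  fixes ext :: "('v, 'w) nsext" and h :: enat
  assumes nse: "nonstandard_extension h ext" and height: "10 \<le> h"
begin

lemma superstructure_std: "superstructure h (std ext)"
  and superstructure_nst: "superstructure h (nst ext)"
  and inj_num: "inj_on (num ext) {1..}"
  and atoms_std: "atoms (std ext) = num ext ` {1..}"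
  and atoms_nst: "atoms (nst ext) = star_nat ext"
  and transfer_bfm: "bsat (std ext) e \<phi> \<longleftrightarrow> bsat (nst ext) (\<lambda>i. star ext (e i)) \<phi>"
  and saturated: "saturated ext"
  and isomorphism_prop: "isomorphism_property ext"
  using nse by (simp_all add: nonstandard_extension_def transfer_def)

lemma less_height:
  assumes "n \<le> 9"
  shows "enat n < h"
proof -
  have "enat n < 10"
    using assms by (simp add: numeral_eq_enat)
  then show ?thesis using height by simp
qed

section \<open>Transfer of first-order formulas about numbers\<close>

definition star_num :: "nat \<Rightarrow> 'w" where
  "star_num n = star ext (num ext n)"

text \<open>\<open>star_rel\<close> speaks of some set object that collects the coded tuples.
  Extensionality makes it unique, so it can be named and used as a parameter of bounded
  formulas.\<close>

definition rel_set :: "nat list set \<Rightarrow> 'v" where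
  "rel_set R = (THE r. is_set (std ext) r {s. \<exists>ns\<in>R. is_tuple (std ext) (map (num ext) ns) s})"

lemma is_set_rel_set:
  assumes "positive_rel R"
  shows "is_set (std ext) (rel_set R) {s. \<exists>ns\<in>R. is_tuple (std ext) (map (num ext) ns) s}"
proof -
  have "s \<in> level (std ext) 6" if "ns \<in> R" "is_tuple (std ext) (map (num ext) ns) s" for ns s
  proof -
    have ns: "ns \<noteq> []" "length ns \<le> 3" "set ns \<subseteq> {1..}"
      using assms that(1) by (auto simp: positive_rel_def)
    have l: "s \<in> level (std ext) (2 * length ns)"
      using is_tuple_level[OF that(2)] ns by (simp add: atoms_std image_mono)
    have "level (std ext) m \<subseteq> level (std ext) (m + k)" for m k
      by (induction k) auto
    from this[of "2 * length ns" "6 - 2 * length ns"] show ?thesis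
      using l ns(2) by auto
  qed
  then have sub: "{s. \<exists>ns\<in>R. is_tuple (std ext) (map (num ext) ns) s} \<subseteq> level (std ext) 6"
    by blast
  obtain r where r: "is_set (std ext) r {s. \<exists>ns\<in>R. is_tuple (std ext) (map (num ext) ns) s}"
    using superstructure_set_exists[OF superstructure_std less_height, of 6, OF _ sub] by auto
  show ?thesis
    unfolding rel_set_def using r is_set_unique[OF superstructure_std _ r] by (rule theI)
qed

lemma star_rel_iff:
  assumes "positive_rel R"
  shows "star_rel ext R xs \<longleftrightarrow> (\<exists>t. is_tuple (nst ext) xs t \<and> elt (nst ext) t (star ext (rel_set R)))"
proof -
  have "is_set (std ext) r {s. \<exists>ns\<in>R. is_tuple (std ext) (map (num ext) ns) s} \<longleftrightarrow> r = rel_set R" for r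
    using is_set_rel_set[OF assms] is_set_unique[OF superstructure_std _ is_set_rel_set[OF assms]]
    by blast
  then show ?thesis
    unfolding star_rel_def by simp
qed

lemma elt_rel_set_iff:
  assumes "positive_rel R" "ns \<noteq> []" "length ns \<le> 3" "set ns \<subseteq> {1..}"
  shows "(\<exists>t. is_tuple (std ext) (map (num ext) ns) t \<and> elt (std ext) t (rel_set R)) \<longleftrightarrow> ns \<in> R"
proof
  assume "\<exists>t. is_tuple (std ext) (map (num ext) ns) t \<and> elt (std ext) t (rel_set R)"
  then obtain t where t: "is_tuple (std ext) (map (num ext) ns) t" "elt (std ext) t (rel_set R)"
    by blast
  then obtain ms where ms: "ms \<in> R" "is_tuple (std ext) (map (num ext) ms) t"
    using is_set_rel_set[OF assms(1)] by (auto simp: is_set_def)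
  then have m: "ms \<noteq> []" "set ms \<subseteq> {1..}"
    using assms(1) by (auto simp: positive_rel_def)
  have "map (num ext) ns = map (num ext) ms"
    by (rule is_tuple_inject_atoms[OF superstructure_std t(1) ms(2)])
      (use assms m in \<open>auto simp: atoms_std\<close>)
  moreover have "inj_on (num ext) (set ns \<union> set ms)"
    by (rule inj_on_subset[OF inj_num]) (use assms(4) m(2) in blast)
  ultimately have "ns = ms"
    by (simp add: inj_on_map_eq_map)
  then show "ns \<in> R" using ms by simp
next
  assume "ns \<in> R"
  moreover have "\<exists>t. is_tuple (std ext) (map (num ext) ns) t"
    by (rule is_tuple_exists[OF superstructure_std])
      (use assms less_height in \<open>auto simp: atoms_std\<close>)
  ultimately show "\<exists>t. is_tuple (std ext) (map (num ext) ns) t \<and> elt (std ext) t (rel_set R)"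
    using is_set_rel_set[OF assms(1)] unfolding is_set_def by blast
qed

definition nat_set :: 'v where
  "nat_set = rel_set (rel1 (\<lambda>_. True))"

lemma elt_nat_set: "elt (std ext) y nat_set \<longleftrightarrow> y \<in> num ext ` {1..}"
proof -
  have "elt (std ext) y nat_set \<longleftrightarrow> (\<exists>ns\<in>rel1 (\<lambda>_. True). is_tuple (std ext) (map (num ext) ns) y)"
    using is_set_rel_set[of "rel1 (\<lambda>_. True)"] by (simp add: is_set_def nat_set_def)
  then show ?thesis by (auto simp: rel1_def)
qed

lemma star_set_iff:
  assumes "A \<subseteq> {1..}"
  shows "x \<in> star_set ext A \<longleftrightarrow> star_rel ext (rel1 (\<lambda>n. n \<in> A)) [x]"
proof -
  have "{[n] |n. n \<in> A} = rel1 (\<lambda>n. n \<in> A)"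
    using assms by (auto simp: rel1_def)
  then show ?thesis by (simp add: star_set_def)
qed

lemma elt_star_nat_set: "{y. elt (nst ext) y (star ext nat_set)} = star_nat ext"
proof -
  have "rel1 (\<lambda>n. n \<in> {1..}) = rel1 (\<lambda>_. True)"
    by (auto simp: rel1_def)
  then show ?thesis
    by (auto simp: star_set_iff star_rel_iff nat_set_def)
qed

text \<open>The formula is moved to the atoms, coded as a bounded formula and transferred with its
  numbers and relations as parameters of the assignment.\<close>

theorem transfer_form:
  assumes "range e \<subseteq> {1..}"
  shows "fsat {1..} (\<lambda>R xs. xs \<in> R) e \<phi> \<longleftrightarrow> fsat (star_nat ext) (star_rel ext) (\<lambda>i. star_num (e i)) \<phi>"
proof -
  \<comment> \<open>There are uncountably many relations, but only finitely many occur in the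
    formula; these can be numbered and placed at the odd indices of the assignment
    \<open>E\<close>.\<close>
  obtain c :: "nat list set \<Rightarrow> nat" where c: "inj_on c (frels \<phi>)"
    using finite_imp_inj_to_nat_seg[OF finite_frels] by metis
  define E where "E i = (if i = 0 then nat_set else if even i then num ext (e ((i - 8) div 2))
      else rel_set (inv_into (frels \<phi>) c ((i - 9) div 2)))" for i
  have E: "E 0 = nat_set" "E (2 * i + 8) = num ext (e i)" "R \<in> frels \<phi> \<Longrightarrow> E (2 * c R + 9) = rel_set R" for i R
    using c by (auto simp: E_def)
  have "fsat {1..} (\<lambda>R xs. xs \<in> R) e \<phi> \<longleftrightarrow>
      fsat (num ext ` {1..}) (\<lambda>R xs. \<exists>t. is_tuple (std ext) xs t \<and> elt (std ext) t (E (2 * c R + 9)))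
        (num ext \<circ> e) \<phi>"
    by (rule fsat_inj_image[OF inj_num assms])
      (simp add: E(3) elt_rel_set_iff frels_positive)
  also have "\<dots> \<longleftrightarrow> bsat (std ext) E (to_bfm c \<phi>)"
    unfolding bsat_to_bfm[OF superstructure_std] E elt_nat_set by (simp add: comp_def)
  also have "\<dots> \<longleftrightarrow> bsat (nst ext) (\<lambda>i. star ext (E i)) (to_bfm c \<phi>)"
    by (rule transfer_bfm)
  also have "\<dots> \<longleftrightarrow> fsat (star_nat ext)
      (\<lambda>R xs. \<exists>t. is_tuple (nst ext) xs t \<and> elt (nst ext) t (star ext (E (2 * c R + 9)))) (\<lambda>i. star_num (e i)) \<phi>"
    unfolding bsat_to_bfm[OF superstructure_nst] E elt_star_nat_set star_num_def ..
  also have "\<dots> \<longleftrightarrow> fsat (star_nat ext) (star_rel ext) (\<lambda>i. star_num (e i)) \<phi>"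
    by (rule fsat_cong) (simp add: E(3) star_rel_iff frels_positive fun_eq_iff)
  finally show ?thesis .
qed

text \<open>Mostly applied to sentences, where the assignment 1 is just a default value.\<close>

lemma transfer_closed:
  "fsat {1..} (\<lambda>R xs. xs \<in> R) (\<lambda>_. 1) \<phi> \<Longrightarrow> fsat (star_nat ext) (star_rel ext) (\<lambda>_. star_num 1) \<phi>"
  using transfer_form[of "\<lambda>_. 1"] by auto

lemma transfer_one:
  assumes "1 \<le> n"
  shows "star_rel ext (rel1 P) [star_num n] \<longleftrightarrow> P n"
  using transfer_form[of "\<lambda>_. n" "P1 P 0"] assms by auto

lemma transfer_two:
  assumes "1 \<le> m" "1 \<le> n"
  shows "star_rel ext (rel2 P) [star_num m, star_num n] \<longleftrightarrow> P m n"
  using transfer_form[of "\<lambda>i. if i = 0 then m else n" "P2 P 0 1"] assms by auto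

lemma rel1_positive: "star_rel ext (rel1 P) [x] \<longleftrightarrow> x \<in> star_set ext {n. 1 \<le> n \<and> P n}"
  by (subst star_set_iff) (auto simp: rel1_def intro: arg_cong2[where f = "star_rel ext"])

lemma star_num_in_star_set_iff:
  assumes "A \<subseteq> {1..}" "1 \<le> n"
  shows "star_num n \<in> star_set ext A \<longleftrightarrow> n \<in> A"
  using assms by (simp add: star_set_iff transfer_one)

lemma star_num_in_star_nat [simp]: "1 \<le> n \<Longrightarrow> star_num n \<in> star_nat ext"
  by (subst star_num_in_star_set_iff) auto

lemmas star_num_in_star_nat' [simp] = star_num_in_star_nat[unfolded One_nat_def]

lemma inj_star_num: "inj_on star_num {1..}"
proof (rule inj_onI)
  fix m n :: nat
  assume "m \<in> {1..}" "n \<in> {1..}" "star_num m = star_num n"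
  then show "m = n"
    using transfer_form[of "\<lambda>i. if i = 0 then m else n" "FEq 0 1"] by auto
qed

text \<open>A \<open>form\<close> speaks of elements of \<open>star_nat ext\<close> only, so it
  cannot say that an extended relation has no other entries. A bounded quantifier over the relation
  itself can; \<open>star_rel3_dom\<close> works in the same way.\<close>

lemma star_rel1_dom:
  assumes "star_rel ext (rel1 P) [x]"
  shows "x \<in> star_nat ext"
proof -
  define E where "E i = (if i = 0 then nat_set else rel_set (rel1 P))" for i :: nat
  have "elt (std ext) t (rel_set (rel1 P)) \<longleftrightarrow>
      (\<exists>ns\<in>rel1 P. is_tuple (std ext) (map (num ext) ns) t)" for t
    using is_set_rel_set[of "rel1 P"] by (simp add: is_set_def)
  then have "bsat (std ext) E (BAll 8 9 (BMem 8 0))"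
    by (auto simp: E_def elt_nat_set rel1_def)
  then have "bsat (nst ext) (\<lambda>i. star ext (E i)) (BAll 8 9 (BMem 8 0))"
    using transfer_bfm by blast
  then show ?thesis
    using assms elt_star_nat_set by (auto simp: E_def star_rel_iff)
qed

lemma star_set_subset: "A \<subseteq> {1..} \<Longrightarrow> star_set ext A \<subseteq> star_nat ext"
  using star_rel1_dom by (auto simp: star_set_iff)

lemma star_rel3_dom:
  assumes "star_rel ext (rel3 P) [x, y, z]"
  shows "x \<in> star_nat ext \<and> y \<in> star_nat ext \<and> z \<in> star_nat ext"
proof -
  define E where "E i = (if i = 0 then nat_set else rel_set (rel3 P))" for i :: nat
  define \<psi> where "\<psi> = BAll 7 9 (BEx 8 0 (BEx 10 0 (BEx 12 0 (BTuple [8, 10, 12] 7))))"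
  have \<psi>: "bsat U e \<psi> \<longleftrightarrow> (\<forall>t. elt U t (e 9) \<longrightarrow> (\<exists>x. elt U x (e 0) \<and>
      (\<exists>y. elt U y (e 0) \<and> (\<exists>z. elt U z (e 0) \<and> is_tuple U [x, y, z] t))))"
    if "superstructure h U" for U :: "('c, 'd) universe_scheme" and e
    using bsat_BTuple[OF that, of "[8, 10, 12]"] unfolding \<psi>_def
    by (simp del: BTuple.simps is_tuple.simps)
  have "elt (std ext) t (rel_set (rel3 P)) \<longleftrightarrow>
      (\<exists>ns\<in>rel3 P. is_tuple (std ext) (map (num ext) ns) t)" for t
    using is_set_rel_set[of "rel3 P"] by (simp add: is_set_def)
  then have "\<exists>x. x \<in> num ext ` {1..} \<and> (\<exists>y. y \<in> num ext ` {1..} \<and>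
      (\<exists>z. z \<in> num ext ` {1..} \<and> is_tuple (std ext) [x, y, z] t))"
    if "elt (std ext) t (rel_set (rel3 P))" for t
    using that by (fastforce simp: rel3_def simp del: is_tuple.simps)
  moreover have E: "E 0 = nat_set" "E 9 = rel_set (rel3 P)"
    by (simp_all add: E_def)
  ultimately have "bsat (std ext) E \<psi>"
    unfolding \<psi>[OF superstructure_std] E elt_nat_set by blast
  then have "bsat (nst ext) (\<lambda>i. star ext (E i)) \<psi>"
    using transfer_bfm by blast
  moreover obtain t where t: "is_tuple (nst ext) [x, y, z] t" "elt (nst ext) t (star ext (rel_set (rel3 P)))"
    using assms by (auto simp: star_rel_iff simp del: is_tuple.simps)
  moreover have "elt (nst ext) u (star ext nat_set) \<longleftrightarrow> u \<in> star_nat ext" for u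
    using elt_star_nat_set by blast
  ultimately obtain x' y' z' where *: "x' \<in> star_nat ext" "y' \<in> star_nat ext" "z' \<in> star_nat ext"
      "is_tuple (nst ext) [x', y', z'] t"
    unfolding \<psi>[OF superstructure_nst] E by blast
  have "[x, y, z] = [x', y', z']"
    by (rule is_tuple_inject[OF superstructure_nst t(1) *(4)]) simp
  then show ?thesis using * by simp
qed

section \<open>Saturation\<close>

text \<open>For each number \<open>x\<close> the set of all \<open>y\<close> with
  \<open>P y x\<close> is an element of the power set of the numbers. Transfer makes its counterpart
  an element of the extended power set, and such elements are internal.\<close>

lemma internal_section:
  assumes "x \<in> star_nat ext"
  shows "\<exists>s. internal ext s \<and> s \<notin> atoms (nst ext) \<and>
    (\<forall>y. elt (nst ext) y s \<longleftrightarrow> y \<in> star_nat ext \<and> star_rel ext (rel2 P) [y, x])"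
proof -
  have sub: "{s. s \<notin> atoms (std ext) \<and> (\<forall>y. elt (std ext) y s \<longrightarrow> y \<in> atoms (std ext))} \<subseteq> level (std ext) 1"
    by auto
  obtain pn where pn: "is_set (std ext) pn
      {s. s \<notin> atoms (std ext) \<and> (\<forall>y. elt (std ext) y s \<longrightarrow> y \<in> atoms (std ext))}"
    using superstructure_set_exists[OF superstructure_std less_height, of 1, OF _ sub] by auto
  define E where "E i = (if i = 0 then nat_set else if i = 3 then pn else rel_set (rel2 P))" for i :: nat
  have E: "E 0 = nat_set" "E 3 = pn" "E 9 = rel_set (rel2 P)"
    by (simp_all add: E_def)
  \<comment> \<open>Variable 3 holds the power set \<open>pn\<close>. The atoms are exactly the
    numbers, so \<open>BNeg (BMem 2 0)\<close> says that \<open>s\<close> is not an atom. As only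
    one relation occurs, the constant numbering puts it at index 9.\<close>
  define \<psi> where "\<psi> = BAll 10 0 (BEx 2 3 (BConj (BConj (BNeg (BMem 2 0)) (BAll 8 2 (BMem 8 0)))
    (BAll 8 0 (BIff (BMem 8 2) (to_bfm (\<lambda>_. 0) (P2 P 0 1))))))"
  have \<psi>: "bsat U e \<psi> \<longleftrightarrow> (\<forall>x. elt U x (e 0) \<longrightarrow> (\<exists>s. elt U s (e 3) \<and> \<not> elt U s (e 0) \<and>
      (\<forall>y. elt U y s \<longrightarrow> elt U y (e 0)) \<and>
      (\<forall>y. elt U y (e 0) \<longrightarrow> (elt U y s \<longleftrightarrow> (\<exists>t. is_tuple U [y, x] t \<and> elt U t (e 9))))))"
    if "superstructure h U" for U :: "('c, 'd) universe_scheme" and e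
    unfolding \<psi>_def by (simp add: bsat_to_bfm[OF that] del: to_bfm.simps is_tuple.simps)
  have "bsat (std ext) E \<psi>"
    unfolding \<psi>[OF superstructure_std]
  proof (intro allI impI)
    fix x assume "elt (std ext) x (E 0)"
    then obtain k where k: "x = num ext k" "1 \<le> k"
      by (auto simp: E_def elt_nat_set)
    have sub: "num ext ` {m. 1 \<le> m \<and> P m k} \<subseteq> level (std ext) 0"
      by (auto simp: atoms_std)
    obtain s where s: "is_set (std ext) s (num ext ` {m. 1 \<le> m \<and> P m k})"
      using superstructure_set_exists[OF superstructure_std less_height, of 0, OF _ sub] by auto
    have s_elt: "elt (std ext) y s \<longleftrightarrow> y \<in> num ext ` {m. 1 \<le> m \<and> P m k}" for y
      using s by (simp add: is_set_def)
    then have s_sub: "\<forall>y. elt (std ext) y s \<longrightarrow> y \<in> num ext ` {1..}"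
      by auto
    have "s \<notin> atoms (std ext)"
      using s by (simp add: is_set_def)
    then have "elt (std ext) s pn"
      using pn s_elt by (auto simp: is_set_def atoms_std)
    moreover have "elt (std ext) y s \<longleftrightarrow> (\<exists>t. is_tuple (std ext) [y, x] t \<and> elt (std ext) t (rel_set (rel2 P)))"
      if "y \<in> num ext ` {1..}" for y
    proof -
      obtain m where m: "y = num ext m" "1 \<le> m" using \<open>y \<in> num ext ` {1..}\<close> by auto
      have "elt (std ext) y s \<longleftrightarrow> P m k"
        using m inj_num by (auto simp: s_elt inj_on_eq_iff)
      then show ?thesis
        using elt_rel_set_iff[of "rel2 P" "[m, k]"] m k by simp
    qed
    ultimately show "\<exists>s. elt (std ext) s (E 3) \<and> \<not> elt (std ext) s (E 0) \<and>
        (\<forall>y. elt (std ext) y s \<longrightarrow> elt (std ext) y (E 0)) \<and>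
        (\<forall>y. elt (std ext) y (E 0) \<longrightarrow>
          (elt (std ext) y s \<longleftrightarrow> (\<exists>t. is_tuple (std ext) [y, x] t \<and> elt (std ext) t (E 9))))"
      using \<open>s \<notin> atoms (std ext)\<close> s_sub unfolding E elt_nat_set atoms_std by blast
  qed
  then have \<psi>_nst: "bsat (nst ext) (\<lambda>i. star ext (E i)) \<psi>"
    using transfer_bfm by blast
  have N: "elt (nst ext) u (star ext nat_set) \<longleftrightarrow> u \<in> star_nat ext" for u
    using elt_star_nat_set by blast
  have "x \<in> star_nat ext \<longrightarrow> (\<exists>s. elt (nst ext) s (star ext pn) \<and> s \<notin> star_nat ext \<and>
      (\<forall>y. elt (nst ext) y s \<longrightarrow> y \<in> star_nat ext) \<and>
      (\<forall>y. y \<in> star_nat ext \<longrightarrow>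
        (elt (nst ext) y s \<longleftrightarrow> (\<exists>t. is_tuple (nst ext) [y, x] t \<and> elt (nst ext) t (star ext (rel_set (rel2 P)))))))"
    by (rule \<psi>_nst[unfolded \<psi>[OF superstructure_nst] E N, THEN spec])
  then obtain s where s: "elt (nst ext) s (star ext pn)" "s \<notin> star_nat ext"
      "\<forall>y. elt (nst ext) y s \<longrightarrow> y \<in> star_nat ext"
      "\<forall>y. y \<in> star_nat ext \<longrightarrow>
        (elt (nst ext) y s \<longleftrightarrow> (\<exists>t. is_tuple (nst ext) [y, x] t \<and> elt (nst ext) t (star ext (rel_set (rel2 P)))))"
    using assms by blast
  then show ?thesis
    unfolding internal_def atoms_nst star_rel_iff[OF positive_rel(2)] by blast
qed

theorem saturation:
  assumes "J \<lesssim> (UNIV :: nat set set)" "x \<in> star_nat ext"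
    and "\<And>K. finite K \<Longrightarrow> K \<subseteq> J \<Longrightarrow> \<exists>y\<in>star_nat ext. \<forall>j\<in>K. star_rel ext (rel2 (P j)) [y, x]"
  shows "\<exists>y\<in>star_nat ext. \<forall>j\<in>J. star_rel ext (rel2 (P j)) [y, x]"
\<comment> \<open>Without any index, saturation need not yield a point of
  \<open>star_nat ext\<close>; \<open>x\<close> itself serves then.\<close>
proof (cases "J = {}")
  case False
  have "\<forall>j. \<exists>s. internal ext s \<and>
      (\<forall>y. elt (nst ext) y s \<longleftrightarrow> y \<in> star_nat ext \<and> star_rel ext (rel2 (P j)) [y, x])"
    using internal_section[OF assms(2)] by blast
  then obtain s where s: "\<And>j. internal ext (s j)"
      "\<And>j y. elt (nst ext) y (s j) \<longleftrightarrow> y \<in> star_nat ext \<and> star_rel ext (rel2 (P j)) [y, x]"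
    by (elim choice[THEN exE]) blast
  have "s ` J \<lesssim> (UNIV :: nat set set)"
    using image_lepoll assms(1) lepoll_trans by blast
  moreover have "\<exists>y. \<forall>t\<in>D. elt (nst ext) y t" if D: "finite D" "D \<subseteq> s ` J" for D
  proof -
    obtain K where "K \<subseteq> J" "finite K" "D = s ` K"
      using finite_subset_image[OF D] by blast
    then show ?thesis using assms(3)[of K] s(2) by auto
  qed
  ultimately obtain y where "\<forall>t\<in>s ` J. elt (nst ext) y t"
    using saturated[unfolded saturated_def, rule_format, of "s ` J"] s(1) by blast
  then show ?thesis using False s(2) by auto
qed (use assms(2) in auto)

section \<open>Initial segments and cardinals\<close>

abbreviation star_segment :: "'w \<Rightarrow> 'w set" where
  "star_segment z \<equiv> {a \<in> star_nat ext. star_le ext a z}"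

lemma star_le_iff: "star_le ext a z \<longleftrightarrow> star_rel ext (rel2 (\<le>)) [a, z]"
  by (simp add: star_le_def rel2_def)

lemma star_segment_num: "1 \<le> n \<Longrightarrow> star_segment (star_num n) = star_num ` {1..n}"
proof (induction n rule: dec_induct)
  case base
  \<comment> \<open>Variable 0 is free here and has the value 1.\<close>
  have "fsat {1..} (\<lambda>R xs. xs \<in> R) (\<lambda>_. 1) (FAll 1 (FIff (P2 (\<le>) 1 0) (FEq 1 0)))"
    by auto
  from transfer_closed[OF this] show ?case
    by (auto simp: star_le_iff)
next
  case (step n)
  have "fsat {1..} (\<lambda>R xs. xs \<in> R) (\<lambda>i. if i = 0 then n else Suc n)
      (FAll 2 (FIff (P2 (\<le>) 2 1) (FOr (P2 (\<le>) 2 0) (FEq 2 1))))"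
    using step by auto
  then have "\<forall>a\<in>star_nat ext. star_le ext a (star_num (Suc n)) \<longleftrightarrow>
      star_le ext a (star_num n) \<or> a = star_num (Suc n)"
    using step by (subst (asm) transfer_form) (auto simp: star_le_iff)
  then have "star_segment (star_num (Suc n)) = insert (star_num (Suc n)) (star_segment (star_num n))"
    by auto
  then show ?case using step by (auto simp: atLeastAtMostSuc_conv)
qed

text \<open>By totality of the order the alternative is that \<open>z\<close> lies in the segment of
  \<open>n\<close>, which contains standard numbers only.\<close>

lemma infinite_nats_ge:
  assumes "z \<in> infinite_nats ext" "1 \<le> n"
  shows "star_le ext (star_num n) z"
proof -
  have "fsat {1..} (\<lambda>R xs. xs \<in> R) (\<lambda>_. n) (FAll 1 (FOr (P2 (\<le>) 0 1) (P2 (\<le>) 1 0)))"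
    using assms by auto
  then have "\<forall>z\<in>star_nat ext. star_le ext (star_num n) z \<or> star_le ext z (star_num n)"
    using assms by (subst (asm) transfer_form) (auto simp: star_le_iff)
  moreover have "z \<in> star_nat ext" "z \<notin> star_num ` {1..n}"
    using assms(1) by (auto simp: infinite_nats_def star_num_def)
  ultimately show ?thesis
    using star_segment_num[OF assms(2)] by blast
qed

lemma infinite_star_segment:
  assumes "z \<in> infinite_nats ext"
  shows "infinite (star_segment z)"
proof -
  have "star_num ` {1..} \<subseteq> star_segment z"
    using infinite_nats_ge[OF assms] by auto
  moreover have "infinite (star_num ` {1..})"
    using inj_star_num infinite_Ici by (simp add: finite_image_iff)
  ultimately show ?thesis using finite_subset by blast
qed

lemma star_nat_cases:
  assumes "m \<in> star_nat ext"
  obtains n where "1 \<le> n" "m = star_num n" | "m \<in> infinite_nats ext"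
  using assms by (auto simp: infinite_nats_def star_num_def)

end

text \<open>All infinite initial segments are isomorphic as structures for the empty language, because pure
  equality formulas cannot tell infinite sets apart (a back-and-forth argument).\<close>

lemma equality_extend:
  assumes "finite V" "infinite D'" "range e' \<subseteq> D'" and e: "\<forall>i\<in>V. \<forall>j\<in>V. e i = e j \<longleftrightarrow> e' i = e' j"
  shows "\<exists>d'\<in>D'. \<forall>i\<in>insert k V. \<forall>j\<in>insert k V. (e(k := d)) i = (e(k := d)) j \<longleftrightarrow> (e'(k := d')) i = (e'(k := d')) j"
proof (cases "\<exists>j\<in>V - {k}. e j = d")
  case True
  then obtain j where "j \<in> V" "j \<noteq> k" "e j = d" by blast
  then show ?thesis
    using assms(3) e by (intro bexI[of _ "e' j"]) auto
next
  case False
  have "finite (e' ` V)" using assms(1) by simp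
  then obtain d' where "d' \<in> D'" "d' \<notin> e' ` V"
    using assms(2) by (meson finite_subset subsetI)
  then show ?thesis
    using False e by (intro bexI[of _ d']) auto
qed

text \<open>The invariant is the equality pattern of the values on a finite set \<open>V\<close> of
  variables. Finiteness of \<open>V\<close> leaves room for a fresh value whenever a quantifier is
  passed.\<close>

lemma sat_equality_language:
  assumes "wf_fm [] [] \<phi>" "finite V" "free_vars \<phi> \<subseteq> V"
    "infinite (dom M)" "infinite (dom M')" "range e \<subseteq> dom M" "range e' \<subseteq> dom M'"
    "\<forall>i\<in>V. \<forall>j\<in>V. e i = e j \<longleftrightarrow> e' i = e' j"
  shows "sat M e \<phi> \<longleftrightarrow> sat M' e' \<phi>"
  using assms
proof (induction \<phi> arbitrary: V e e')
  case (Eql s t)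
  then obtain i j where "s = Var i" "t = Var j"
    by (cases s; cases t) auto
  then show ?case using Eql by auto
next
  case (All k \<phi>)
  have ins: "finite (insert k V)" "free_vars \<phi> \<subseteq> insert k V" "wf_fm [] [] \<phi>"
    using All.prems by auto
  have r: "range (e(k := d)) \<subseteq> dom M" if "d \<in> dom M" for d
    using that All.prems(6) by auto
  have r': "range (e'(k := d)) \<subseteq> dom M'" if "d \<in> dom M'" for d
    using that All.prems(7) by auto
  have "\<exists>d'\<in>dom M'. sat M (e(k := d)) \<phi> \<longleftrightarrow> sat M' (e'(k := d')) \<phi>" if d: "d \<in> dom M" for d
  proof -
    from equality_extend[OF All.prems(2,5,7,8), where k = k and d = d]
    obtain d' where d': "d' \<in> dom M'" "\<forall>i\<in>insert k V. \<forall>j\<in>insert k V.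
        (e(k := d)) i = (e(k := d)) j \<longleftrightarrow> (e'(k := d')) i = (e'(k := d')) j"
      by (rule bexE)
    from All.IH[OF ins(3,1,2) All.prems(4,5) r[OF d] r'[OF d'(1)] d'(2)] d'(1) show ?thesis
      by (rule bexI)
  qed
  moreover have "\<exists>d\<in>dom M. sat M (e(k := d)) \<phi> \<longleftrightarrow> sat M' (e'(k := d')) \<phi>" if d': "d' \<in> dom M'" for d'
  proof -
    have "\<forall>i\<in>V. \<forall>j\<in>V. e' i = e' j \<longleftrightarrow> e i = e j"
      using All.prems(8) by blast
    from equality_extend[OF All.prems(2,4,6) this, where k = k and d = d']
    obtain d where d: "d \<in> dom M" "\<forall>i\<in>insert k V. \<forall>j\<in>insert k V.
        (e'(k := d')) i = (e'(k := d')) j \<longleftrightarrow> (e(k := d)) i = (e(k := d)) j"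
      by (rule bexE)
    have "\<forall>i\<in>insert k V. \<forall>j\<in>insert k V.
        (e(k := d)) i = (e(k := d)) j \<longleftrightarrow> (e'(k := d')) i = (e'(k := d')) j"
      by (intro ballI) (simp only: d(2)[rule_format])
    from All.IH[OF ins(3,1,2) All.prems(4,5) r[OF d(1)] r'[OF d'] this] d(1) show ?thesis
      by (rule bexI)
  qed
  ultimately show ?case by (simp del: fun_upd_apply) blast
next
  case (Conj \<phi>1 \<phi>2)
  then have "sat M e \<phi>1 \<longleftrightarrow> sat M' e' \<phi>1" "sat M e \<phi>2 \<longleftrightarrow> sat M' e' \<phi>2"
    by simp_all
  then show ?case by simp
next
  case (Neg \<phi>)
  then have "sat M e \<phi> \<longleftrightarrow> sat M' e' \<phi>"
    by simp
  then show ?case by simp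
qed simp

context nonstandard
begin

text \<open>Segments are internal by \<open>internal_section\<close>. For the empty language
  Henson's property turns elementary equivalence into a bare bijection; this is what makes
  \<infinity> a single cardinal.\<close>

lemma star_segments_eqpoll:
  assumes "z \<in> infinite_nats ext" "w \<in> infinite_nats ext"
  shows "star_segment z \<approx> star_segment w"
proof -
  define M :: "'w \<Rightarrow> 'w fo_structure" where
    "M z = \<lparr>dom = star_segment z, rels = \<lambda>_. {}, funs = \<lambda>_. undefined\<rparr>" for z
  have "internally_presented ext [] [] (M z)" if z: "z \<in> infinite_nats ext" for z
  proof -
    have ne: "star_segment z \<noteq> {}"
      using infinite_star_segment[OF z] by (metis finite.emptyI)
    have "z \<in> star_nat ext" using z by (simp add: infinite_nats_def)
    from internal_section[OF this, of "(\<le>)"] show ?thesis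
      using ne by (auto simp: internally_presented_def M_def is_set_def star_le_iff)
  qed
  moreover have "elementarily_equivalent [] [] (M z) (M w)"
  proof -
    have inf: "infinite (dom (M z))" "infinite (dom (M w))"
      using infinite_star_segment assms by (simp_all add: M_def)
    have "holds (M z) \<phi> \<longleftrightarrow> holds (M w) \<phi>" if "wf_fm [] [] \<phi>" "free_vars \<phi> = {}" for \<phi>
    proof -
      have *: "sat (M z) e \<phi> \<longleftrightarrow> sat (M w) e' \<phi>" if "range e \<subseteq> dom (M z)" "range e' \<subseteq> dom (M w)" for e e'
        using sat_equality_language[of \<phi> "{}" "M z" "M w" e e'] inf that \<open>wf_fm [] [] \<phi>\<close> \<open>free_vars \<phi> = {}\<close>
        by simp
      obtain a b where "a \<in> dom (M z)" "b \<in> dom (M w)"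
        using inf by (metis ex_in_conv finite.emptyI)
      then have "range (\<lambda>_ :: nat. a) \<subseteq> dom (M z)" "range (\<lambda>_ :: nat. b) \<subseteq> dom (M w)" by auto
      then show ?thesis using * unfolding holds_def by blast
    qed
    then show ?thesis by (simp add: elementarily_equivalent_def)
  qed
  ultimately have "isomorphic [] [] (M z) (M w)"
    using isomorphism_prop assms unfolding isomorphism_property_def by blast
  then show ?thesis by (auto simp: isomorphic_def M_def eqpoll_def)
qed

lemma has_card_eqpoll:
  assumes "has_card ext S k" "S \<approx> T"
  shows "has_card ext T k"
proof (cases k)
  case (enat n)
  then show ?thesis
    using assms eqpoll_finite_iff[OF assms(2)] by (auto simp: has_card_def eqpoll_iff_card)
next
  case infinity
  then show ?thesis
    using assms by (auto simp: has_card_def) (meson eqpoll_sym eqpoll_trans)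
qed

lemma has_card_unique:
  assumes "has_card ext S k" "has_card ext S k'"
  shows "k = k'"
proof -
  have "infinite S" if "has_card ext S \<infinity>"
    using that infinite_star_segment eqpoll_finite_iff by (auto simp: has_card_def)
  then show ?thesis
    using assms by (cases k; cases k') (auto simp: has_card_def)
qed

lemma has_card_imp_eqpoll:
  assumes "has_card ext S k" "has_card ext T k"
  shows "S \<approx> T"
proof (cases k)
  case (enat n)
  then show ?thesis
    using assms by (simp add: has_card_def eqpoll_iff_card)
next
  case infinity
  then show ?thesis
    using assms star_segments_eqpoll unfolding has_card_def by simp (meson eqpoll_sym eqpoll_trans)
qed

lemma cardinal_eqI: "has_card ext S k \<Longrightarrow> cardinal ext S = k"
  unfolding cardinal_def using has_card_unique by blast

end

section \<open>Ultrafilters\<close>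

lemma ultrafilter_compl:
  assumes "ultrafilter_on S \<F>" "A \<subseteq> S"
  shows "S - A \<in> \<F> \<longleftrightarrow> A \<notin> \<F>"
proof -
  have "A \<inter> (S - A) = {}" by blast
  then show ?thesis
    using assms unfolding ultrafilter_on_def by metis
qed

lemma ultrafilter_eqI:
  assumes F: "ultrafilter_on S \<F>" and G: "ultrafilter_on S \<G>" and "\<F> \<subseteq> \<G>"
  shows "\<F> = \<G>"
proof (rule antisym[OF \<open>\<F> \<subseteq> \<G>\<close>], rule subsetI)
  fix A assume A: "A \<in> \<G>"
  then have "A \<subseteq> S" using G by (auto simp: ultrafilter_on_def)
  then show "A \<in> \<F>"
    using ultrafilter_compl[OF F] ultrafilter_compl[OF G] A assms(3) by blast
qed

lemma ultrafilter_finite_Inter: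
  assumes "ultrafilter_on S \<F>" "finite K" "K \<subseteq> \<F>"
  shows "S \<inter> \<Inter>K \<in> \<F>"
  using assms(2,3)
proof (induction K rule: finite_induct)
  case empty
  then show ?case using assms(1) by (simp add: ultrafilter_on_def)
next
  case (insert A K)
  then have "A \<inter> (S \<inter> \<Inter>K) \<in> \<F>"
    using assms(1) by (simp add: ultrafilter_on_def)
  moreover have "A \<inter> (S \<inter> \<Inter>K) = S \<inter> \<Inter>(insert A K)" by blast
  ultimately show ?case by simp
qed

lemma ultrafilter_mono:
  assumes "ultrafilter_on S \<F>" "A \<in> \<F>" "A \<subseteq> B" "B \<subseteq> S"
  shows "B \<in> \<F>"
  using assms unfolding ultrafilter_on_def by blast

lemma ultrafilter_Int:
  assumes "ultrafilter_on S \<F>" "A \<in> \<F>" "B \<in> \<F>"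
  shows "A \<inter> B \<in> \<F>"
  using assms unfolding ultrafilter_on_def by blast

context nonstandard
begin

section \<open>Types of nonstandard numbers\<close>

lemma star_set_Diff:
  assumes "A \<subseteq> {1..}" "x \<in> star_nat ext"
  shows "x \<in> star_set ext ({1..} - A) \<longleftrightarrow> x \<notin> star_set ext A"
proof -
  have "\<forall>x\<in>star_nat ext. star_rel ext (rel1 (\<lambda>n. n \<in> {1..} - A)) [x] \<longleftrightarrow> \<not> star_rel ext (rel1 (\<lambda>n. n \<in> A)) [x]"
    using transfer_closed[of "FAll 0 (FIff (P1 (\<lambda>n. n \<in> {1..} - A) 0) (FNot (P1 (\<lambda>n. n \<in> A) 0)))"]
    by simp
  then show ?thesis
    using assms by (simp add: star_set_iff)
qed

lemma star_set_Int:
  assumes "A \<subseteq> {1..}" "B \<subseteq> {1..}" "x \<in> star_nat ext"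
  shows "x \<in> star_set ext (A \<inter> B) \<longleftrightarrow> x \<in> star_set ext A \<and> x \<in> star_set ext B"
proof -
  have "\<forall>x\<in>star_nat ext. star_rel ext (rel1 (\<lambda>n. n \<in> A \<inter> B)) [x] \<longleftrightarrow>
      star_rel ext (rel1 (\<lambda>n. n \<in> A)) [x] \<and> star_rel ext (rel1 (\<lambda>n. n \<in> B)) [x]"
    using transfer_closed[of "FAll 0 (FIff (P1 (\<lambda>n. n \<in> A \<inter> B) 0)
      (FAnd (P1 (\<lambda>n. n \<in> A) 0) (P1 (\<lambda>n. n \<in> B) 0)))"]
    by simp
  then show ?thesis
    using assms by (simp add: star_set_iff le_infI1)
qed

lemma star_set_mono:
  assumes "A \<subseteq> B" "B \<subseteq> {1..}"
  shows "star_set ext A \<subseteq> star_set ext B"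
proof
  fix x assume x: "x \<in> star_set ext A"
  have "A \<subseteq> {1..}" "A \<inter> B = A" using assms by auto
  then show "x \<in> star_set ext B"
    using star_set_Int[of A B x] star_set_subset[of A] x assms(2) by auto
qed

lemma star_set_empty: "star_set ext {} = {}"
  using star_set_Diff[of "{}"] star_set_subset[of "{}"] by auto

lemma tp_ultrafilter:
  assumes "x \<in> star_nat ext"
  shows "tp ext x \<in> beta_nat"
  unfolding beta_nat_def ultrafilter_on_def tp_def
proof (intro CollectI conjI ballI allI impI)
  fix A B assume "A \<in> {A. A \<subseteq> {1..} \<and> x \<in> star_set ext A}" "A \<subseteq> B \<and> B \<subseteq> {1..}"
  then show "B \<subseteq> {1..}" "x \<in> star_set ext B"
    using star_set_mono[of A B] by auto
qed (use assms star_set_Int star_set_Diff star_set_empty in auto)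

text \<open>\<open>saturation\<close> speaks of binary relations with a parameter; a unary condition
  enters it with a dummy second argument.\<close>

lemma section_const:
  assumes "y \<in> star_nat ext" "x \<in> star_nat ext"
  shows "star_rel ext (rel2 (\<lambda>m n. P m)) [y, x] \<longleftrightarrow> star_rel ext (rel1 P) [y]"
  using transfer_closed[of "FAll 0 (FAll 1 (FIff (P2 (\<lambda>m n. P m) 0 1) (P1 P 0)))"] assms by simp

text \<open>The members of \<F> have the finite intersection property and are at most continuum
  many, so saturation finds a point in all their extensions. Its type contains \<F> and equals it
  because ultrafilters are maximal.\<close>

lemma ultrafilter_generated:
  assumes "\<F> \<in> beta_nat"
  shows "\<exists>x. generates ext x \<F>"
proof -
  have F: "ultrafilter_on {1..} \<F>"
    using assms by (simp add: beta_nat_def)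
  have F_sub: "A \<subseteq> {1..}" if "A \<in> \<F>" for A
    using F that by (auto simp: ultrafilter_on_def)
  have one: "star_num 1 \<in> star_nat ext" by simp
  have "\<exists>y\<in>star_nat ext. \<forall>A\<in>\<F>. star_rel ext (rel2 (\<lambda>m n. m \<in> A)) [y, star_num 1]"
  proof (rule saturation[OF _ one])
    show "\<F> \<lesssim> (UNIV :: nat set set)"
      by (rule subset_imp_lepoll) simp
  next
    fix K assume K: "finite K" "K \<subseteq> \<F>"
    then have "{1..} \<inter> \<Inter>K \<in> \<F>"
      by (rule ultrafilter_finite_Inter[OF F])
    then have "{1..} \<inter> \<Inter>K \<noteq> {}"
      using F unfolding ultrafilter_on_def by metis
    then obtain n where "1 \<le> n" "\<forall>A\<in>K. n \<in> A"
      by auto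
    then show "\<exists>y\<in>star_nat ext. \<forall>A\<in>K. star_rel ext (rel2 (\<lambda>m n. m \<in> A)) [y, star_num 1]"
      by (intro bexI[of _ "star_num n"]) (auto simp: transfer_two)
  qed
  then obtain y where y: "y \<in> star_nat ext" "\<forall>A\<in>\<F>. y \<in> star_set ext A"
    using section_const[OF _ one] F_sub by (auto simp: star_set_iff)
  have "\<F> = tp ext y"
    using tp_ultrafilter[OF y(1)] F y(2) F_sub
    by (intro ultrafilter_eqI[of "{1..}"]) (auto simp: beta_nat_def tp_def)
  then show ?thesis using y(1) by (auto simp: generates_def)
qed

end

section \<open>Counting the sections of a standard relation\<close>

lemma rank_bij:
  fixes S :: "nat set"
  assumes "finite S"
  shows "bij_betw (\<lambda>w. card {v \<in> S. v \<le> w}) S {1..card S}"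
proof -
  let ?r = "\<lambda>w. card {v \<in> S. v \<le> w}"
  have less: "?r w < ?r w'" if "w \<in> S" "w' \<in> S" "w < w'" for w w'
  proof -
    have "{v \<in> S. v \<le> w} \<subset> {v \<in> S. v \<le> w'}" using that by force
    then show ?thesis using assms by (intro psubset_card_mono) auto
  qed
  have inj: "inj_on ?r S"
  proof (rule linorder_inj_onI')
    fix w w' assume "w \<in> S" "w' \<in> S" "w < w'"
    then show "?r w \<noteq> ?r w'" using less[of w w'] by simp
  qed
  have "?r w \<in> {1..card S}" if "w \<in> S" for w
  proof -
    have "{w} \<subseteq> {v \<in> S. v \<le> w}" using that by auto
    from card_mono[OF _ this] card_mono[of S "{v \<in> S. v \<le> w}"] show ?thesis
      using assms by simp
  qed
  then have "?r ` S \<subseteq> {1..card S}" by blast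
  moreover have "card (?r ` S) = card {1..card S}"
    using inj by (simp add: card_image)
  ultimately have "?r ` S = {1..card S}"
    by (intro card_subset_eq) simp_all
  then show ?thesis using inj by (simp add: bij_betw_def)
qed

text \<open>Transfer delivers a bijection as an extended relation, its graph, rather than as a
  function.\<close>

lemma eqpoll_relI:
  assumes "\<And>a. a \<in> A \<Longrightarrow> \<exists>b\<in>B. R a b" "\<And>b. b \<in> B \<Longrightarrow> \<exists>a\<in>A. R a b"
    and inj: "\<And>a a' b. a \<in> A \<Longrightarrow> a' \<in> A \<Longrightarrow> b \<in> B \<Longrightarrow> R a b \<Longrightarrow> R a' b \<Longrightarrow> a = a'"
    and fn: "\<And>a b b'. a \<in> A \<Longrightarrow> b \<in> B \<Longrightarrow> b' \<in> B \<Longrightarrow> R a b \<Longrightarrow> R a b' \<Longrightarrow> b = b'"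
  shows "A \<approx> B"
proof -
  obtain f where f: "\<And>a. a \<in> A \<Longrightarrow> f a \<in> B \<and> R a (f a)"
    using assms(1) by metis
  have "inj_on f A"
  proof (rule inj_onI)
    fix a a' assume "a \<in> A" "a' \<in> A" "f a = f a'"
    then show "a = a'" using inj[of a a' "f a"] f[of a] f[of a'] by simp
  qed
  moreover have "f ` A = B"
  proof (rule antisym)
    show "B \<subseteq> f ` A"
    proof
      fix b assume "b \<in> B"
      then obtain a where "a \<in> A" "R a b" using assms(2) by blast
      then show "b \<in> f ` A" using fn[of a b "f a"] f[of a] \<open>b \<in> B\<close> by blast
    qed
  qed (use f in blast)
  ultimately show ?thesis
    unfolding eqpoll_def bij_betw_def by blast
qed

definition section_card :: "(nat \<Rightarrow> nat \<Rightarrow> bool) \<Rightarrow> nat \<Rightarrow> nat" where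
  "section_card T n = card {w. 1 \<le> w \<and> T w n}"

context nonstandard
begin

text \<open>The rank \<open>card {v \<in> T n. v \<le> w}\<close> of \<open>w\<close> numbers the section at \<open>n\<close> by an initial segment; this transfers.\<close>

definition star_section :: "(nat \<Rightarrow> nat \<Rightarrow> bool) \<Rightarrow> 'w \<Rightarrow> 'w set" where
  "star_section T x = {w \<in> star_nat ext. star_rel ext (rel2 T) [w, x]}"

theorem star_section_card:
  assumes fin: "\<And>n. 1 \<le> n \<Longrightarrow> finite {w. 1 \<le> w \<and> T w n}" and x: "x \<in> star_nat ext"
  shows "\<exists>c. has_card ext (star_section T x) c \<and>
    (\<forall>k. enat k \<le> c \<longleftrightarrow> star_rel ext (rel1 (\<lambda>n. k \<le> section_card T n)) [x])"
proof -
  define G where "G w n k \<longleftrightarrow> T w n \<and> k = card {v \<in> {w. 1 \<le> w \<and> T w n}. v \<le> w}" for w n k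
  have bij: "bij_betw (\<lambda>w. card {v \<in> {w. 1 \<le> w \<and> T w n}. v \<le> w}) {w. 1 \<le> w \<and> T w n} {1..section_card T n}"
    if "1 \<le> n" for n
    using rank_bij[OF fin[OF that]] by (simp add: section_card_def)
  let ?zero = "P1 (\<lambda>n. section_card T n = 0) 0" and ?count = "P2 (\<lambda>n m. section_card T n = m) 0 1"
  \<comment> \<open>Formulas speak of positive numbers only: an empty section has no count among
    them and is treated apart.\<close>
  consider (zero) "star_rel ext (rel1 (\<lambda>n. section_card T n = 0)) [x]"
    | (pos) m where "m \<in> star_nat ext" "star_rel ext (rel2 (\<lambda>n m. section_card T n = m)) [x, m]"
    using transfer_closed[of "FAll 0 (FOr ?zero (FEx 1 ?count))"] x by fastforce
  then show ?thesis
  proof cases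
    case zero
    have "star_section T x = {}"
      using transfer_closed[of "FAll 0 (FImp ?zero (FAll 1 (FNot (P2 T 1 0))))"] fin x zero
      by (auto simp: star_section_def section_card_def)
    then have "has_card ext (star_section T x) 0"
      by (simp add: has_card_def zero_enat_def)
    moreover have "enat k \<le> 0 \<longleftrightarrow> star_rel ext (rel1 (\<lambda>n. k \<le> section_card T n)) [x]" for k
    proof (cases "k = 0")
      case True
      then show ?thesis
        using transfer_closed[of "FAll 0 (P1 (\<lambda>n. k \<le> section_card T n) 0)"] x
        by (simp add: zero_enat_def)
    next
      case False
      then show ?thesis
        using transfer_closed[of "FAll 0 (FImp ?zero (FNot (P1 (\<lambda>n. k \<le> section_card T n) 0)))"] x zero
        by (simp add: zero_enat_def)
    qed
    ultimately show ?thesis by blast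
  next
    case pos
    have "star_section T x \<approx> star_segment m"
    proof (rule eqpoll_relI[where R = "\<lambda>w k. star_rel ext (rel3 G) [w, x, k]"])
      fix w assume w: "w \<in> star_section T x"
      have "fsat {1..} (\<lambda>R xs. xs \<in> R) (\<lambda>_. 1)
          (FAll 0 (FAll 1 (FAll 2 (FImp ?count (FImp (P2 T 2 0) (FEx 3 (FAnd (P3 G 2 0 3) (P2 (\<le>) 3 1))))))))"
      proof (simp del: One_nat_def, intro ballI impI)
        fix n w assume n: "n \<in> {1..}" "w \<in> {1..}" "T w n"
        then show "\<exists>k\<in>{1..}. G w n k \<and> k \<le> section_card T n"
          using bij_betwE[OF bij[of n]] by (auto simp: G_def)
      qed
      from transfer_closed[OF this] have "\<forall>x\<in>star_nat ext. \<forall>m\<in>star_nat ext. \<forall>w\<in>star_nat ext.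
          star_rel ext (rel2 (\<lambda>n m. section_card T n = m)) [x, m] \<longrightarrow> star_rel ext (rel2 T) [w, x] \<longrightarrow>
          (\<exists>k\<in>star_nat ext. star_rel ext (rel3 G) [w, x, k] \<and> star_rel ext (rel2 (\<le>)) [k, m])"
        by simp
      then show "\<exists>k\<in>star_segment m. star_rel ext (rel3 G) [w, x, k]"
        using w x pos unfolding star_section_def star_le_iff by blast
    next
      fix k assume k: "k \<in> star_segment m"
      have "fsat {1..} (\<lambda>R xs. xs \<in> R) (\<lambda>_. 1)
          (FAll 0 (FAll 1 (FAll 3 (FImp ?count (FImp (P2 (\<le>) 3 1) (FEx 2 (FAnd (P2 T 2 0) (P3 G 2 0 3))))))))"
      proof (simp del: One_nat_def, intro ballI impI)
        fix n k assume n: "n \<in> {1..}" "k \<in> {1..}" "k \<le> section_card T n"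
        then have "k \<in> (\<lambda>w. card {v \<in> {w. 1 \<le> w \<and> T w n}. v \<le> w}) ` {w. 1 \<le> w \<and> T w n}"
          using bij_betw_imp_surj_on[OF bij[of n]] by simp
        then show "\<exists>w\<in>{1..}. T w n \<and> G w n k"
          unfolding G_def by blast
      qed
      from transfer_closed[OF this] have "\<forall>x\<in>star_nat ext. \<forall>m\<in>star_nat ext. \<forall>k\<in>star_nat ext.
          star_rel ext (rel2 (\<lambda>n m. section_card T n = m)) [x, m] \<longrightarrow> star_rel ext (rel2 (\<le>)) [k, m] \<longrightarrow>
          (\<exists>w\<in>star_nat ext. star_rel ext (rel2 T) [w, x] \<and> star_rel ext (rel3 G) [w, x, k])"
        by simp
      then show "\<exists>w\<in>star_section T x. star_rel ext (rel3 G) [w, x, k]"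
        using k x pos unfolding star_section_def star_le_iff by blast
    next
      fix w w' k
      assume *: "w \<in> star_section T x" "w' \<in> star_section T x" "k \<in> star_segment m"
        "star_rel ext (rel3 G) [w, x, k]" "star_rel ext (rel3 G) [w', x, k]"
      have "w = w'" if "1 \<le> n" "1 \<le> w" "1 \<le> w'" "G w n k" "G w' n k" for n w w' k
        using bij_betw_imp_inj_on[OF bij[OF that(1)]] that by (auto simp: G_def dest: inj_onD)
      then have "fsat {1..} (\<lambda>R xs. xs \<in> R) (\<lambda>_. 1)
          (FAll 0 (FAll 1 (FAll 2 (FAll 3 (FImp (P3 G 1 0 3) (FImp (P3 G 2 0 3) (FEq 1 2)))))))"
        by (simp del: One_nat_def)
      from transfer_closed[OF this] show "w = w'"
        using * x by (simp add: star_section_def) blast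
    next
      fix w k k'
      assume *: "w \<in> star_section T x" "k \<in> star_segment m" "k' \<in> star_segment m"
        "star_rel ext (rel3 G) [w, x, k]" "star_rel ext (rel3 G) [w, x, k']"
      have "fsat {1..} (\<lambda>R xs. xs \<in> R) (\<lambda>_. 1)
          (FAll 0 (FAll 1 (FAll 2 (FAll 3 (FImp (P3 G 1 0 2) (FImp (P3 G 1 0 3) (FEq 2 3)))))))"
        by (simp add: G_def)
      from transfer_closed[OF this] show "k = k'"
        using * x by (simp add: star_section_def) blast
    qed
    then have eq: "star_segment m \<approx> star_section T x"
      by (rule eqpoll_sym)
    have count: "star_rel ext (rel1 (\<lambda>n. k \<le> section_card T n)) [x] \<longleftrightarrow> star_rel ext (rel1 (\<lambda>m. k \<le> m)) [m]" for k
      using transfer_closed[of "FAll 0 (FAll 1 (FImp ?count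
        (FIff (P1 (\<lambda>n. k \<le> section_card T n) 0) (P1 (\<lambda>m. k \<le> m) 1))))"] x pos
      by simp
    from pos(1) show ?thesis
    proof (cases rule: star_nat_cases)
      case (1 n)
      have "inj_on star_num {1..n}"
        by (rule inj_on_subset[OF inj_star_num]) auto
      then have "has_card ext (star_segment m) (enat n)"
        using 1 by (simp only: star_segment_num has_card_def) (simp add: card_image)
      then have "has_card ext (star_section T x) (enat n)"
        using has_card_eqpoll eq by blast
      then show ?thesis
        using 1 count by (intro exI[of _ "enat n"]) (simp add: transfer_one)
    next
      case 2
      have "has_card ext (star_segment m) \<infinity>"
        using 2 by (auto simp: has_card_def intro: eqpoll_refl)
      then have "has_card ext (star_section T x) \<infinity>"
        using has_card_eqpoll eq by blast
      moreover have "star_rel ext (rel1 (\<lambda>m. k \<le> m)) [m]" for k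
      proof -
        \<comment> \<open>The comparison is with \<open>Suc k\<close> because \<open>k\<close> may
          be 0, which is not in the domain.\<close>
        have "fsat {1..} (\<lambda>R xs. xs \<in> R) (\<lambda>_. Suc k) (FAll 1 (FImp (P2 (\<le>) 0 1) (P1 (\<lambda>m. k \<le> m) 1)))"
          by auto
        then have "\<forall>z\<in>star_nat ext. star_le ext (star_num (Suc k)) z \<longrightarrow> star_rel ext (rel1 (\<lambda>m. k \<le> m)) [z]"
          by (subst (asm) transfer_form) (auto simp: star_le_iff)
        then show ?thesis
          using infinite_nats_ge[OF 2, of "Suc k"] pos(1) by simp
      qed
      ultimately show ?thesis
        using count by (intro exI[of _ \<infinity>]) simp
    qed
  qed
qed

end

section \<open>Convex sets of prime powers\<close>

text \<open>Convex sets of this kind see only the base of a prime power; they tell the ultrafilters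
  of the bases apart.\<close>

definition exponentials :: "nat set \<Rightarrow> nat set" where
  "exponentials D = {p ^ n |p n. p \<in> D \<and> prime p \<and> 1 \<le> n}"

lemma prime_powers_pos: "prime_powers \<subseteq> {1..}"
  by (auto simp: prime_powers_def Suc_le_eq prime_gt_0_nat)

lemma exponentials_subset: "exponentials D \<subseteq> prime_powers"
  unfolding exponentials_def prime_powers_def by blast

lemma prime_power_gt_1:
  assumes "w \<in> prime_powers"
  shows "1 < w"
proof -
  obtain p n where "w = p ^ n" "prime p" "1 \<le> n"
    using assms by (auto simp: prime_powers_def)
  then show ?thesis using one_less_power[of p n] prime_gt_1_nat[of p] by simp
qed

lemma dvd_exponential:
  assumes "q \<in> D" "prime q" "c dvd q ^ m" "c \<noteq> 1"
  shows "c \<in> exponentials D"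
proof -
  obtain k where k: "c = q ^ k"
    using divides_primepow_nat[OF assms(2), of c m] assms(3) by blast
  then have "1 \<le> k" using assms(4) by (cases k) auto
  then show ?thesis using k assms unfolding exponentials_def by blast
qed

lemma dvd_ne_one:
  assumes "w \<in> prime_powers" "w dvd c"
  shows "c \<noteq> 1"
  using prime_power_gt_1[OF assms(1)] assms(2) by auto

lemma dvd_prime_power:
  assumes "w \<in> prime_powers" "c dvd w" "c \<noteq> 1"
  shows "c \<in> prime_powers"
proof -
  obtain q m where "w = q ^ m" "prime q" using assms(1) by (auto simp: prime_powers_def)
  then show ?thesis using dvd_exponential[of q UNIV c m] assms exponentials_subset by auto
qed

lemma convex_exponentials:
  assumes "exponentials D \<noteq> {}"
  shows "exponentials D \<in> convex_sets"
proof -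
  have "convex_set (exponentials D)"
    unfolding convex_set_def
  proof (intro ballI allI impI)
    fix a b c assume *: "a \<in> exponentials D" "b \<in> exponentials D" "a dvd c \<and> c dvd b"
    then have "c \<noteq> 1" using dvd_ne_one exponentials_subset by blast
    moreover obtain q m where "b = q ^ m" "q \<in> D" "prime q"
      using *(2) by (auto simp: exponentials_def)
    ultimately show "c \<in> exponentials D"
      using dvd_exponential[of q D c m] * by blast
  qed
  then show ?thesis using assms exponentials_subset by (simp add: convex_sets_def)
qed

lemma prime_powers_convex: "prime_powers \<in> convex_sets"
proof -
  have "2 ^ 1 \<in> exponentials UNIV"
    unfolding exponentials_def by (intro CollectI exI[of _ 2] exI[of _ 1]) simp
  moreover have "exponentials UNIV = prime_powers"
    by (auto simp: exponentials_def prime_powers_def)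
  ultimately show ?thesis using convex_exponentials[of UNIV] by auto
qed

lemma upward_setsD: "V \<in> upward_sets \<Longrightarrow> a \<in> V \<Longrightarrow> a dvd n \<Longrightarrow> 1 \<le> n \<Longrightarrow> n \<in> V"
  unfolding upward_sets_def up_def by blast

text \<open>With \<open>convex_upward_Diff\<close> this provides enough convex sets to decide
  membership in any upward set for a type that contains \<open>prime_powers\<close>.\<close>

lemma convex_upward_Int:
  assumes V: "V \<in> upward_sets" and "V \<inter> prime_powers \<noteq> {}"
  shows "V \<inter> prime_powers \<in> convex_sets"
proof -
  have "convex_set (V \<inter> prime_powers)"
    unfolding convex_set_def
  proof (intro ballI allI impI)
    fix a b c assume *: "a \<in> V \<inter> prime_powers" "b \<in> V \<inter> prime_powers" "a dvd c \<and> c dvd b"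
    then have "c \<in> prime_powers"
      using dvd_prime_power[of b c] dvd_ne_one[of a c] by blast
    moreover from this have "1 \<le> c" using prime_powers_pos by auto
    ultimately show "c \<in> V \<inter> prime_powers"
      using upward_setsD[OF V, of a c] * by blast
  qed
  then show ?thesis using assms(2) by (simp add: convex_sets_def)
qed

lemma convex_upward_Diff:
  assumes V: "V \<in> upward_sets" and "prime_powers - V \<noteq> {}"
  shows "prime_powers - V \<in> convex_sets"
proof -
  have "convex_set (prime_powers - V)"
    unfolding convex_set_def
  proof (intro ballI allI impI)
    fix a b c assume *: "a \<in> prime_powers - V" "b \<in> prime_powers - V" "a dvd c \<and> c dvd b"
    then have "c \<noteq> 1"
      using dvd_ne_one[of a c] by simp
    then have "c \<in> prime_powers"
      using dvd_prime_power[of b c] * by simp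
    moreover have "1 \<le> b" using * prime_powers_pos by auto
    ultimately show "c \<in> prime_powers - V"
      using upward_setsD[OF V, of c b] * by auto
  qed
  then show ?thesis using assms(2) by (auto simp: convex_sets_def)
qed

lemma subset_up:
  assumes "A \<subseteq> {1..}"
  shows "A \<subseteq> up A"
proof
  fix n assume "n \<in> A"
  moreover from this have "1 \<le> n" using assms by auto
  ultimately show "n \<in> up A" using dvd_refl unfolding up_def by blast
qed

lemma convex_set_Int: "convex_set A \<Longrightarrow> convex_set B \<Longrightarrow> convex_set (A \<inter> B)"
  unfolding convex_set_def by blast

lemma convex_sets_Int:
  assumes "A \<in> convex_sets" "B \<in> convex_sets" "A \<inter> B \<noteq> {}"
  shows "A \<inter> B \<in> convex_sets"
  using assms by (auto simp: convex_sets_def intro: convex_set_Int)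

text \<open>A convex set is the difference of two sets that are closed under multiples, \<open>up A\<close> and \<open>up A - A\<close>.\<close>

lemma convex_mem_sim:
  assumes F: "ultrafilter_on {1..} \<F>" and G: "ultrafilter_on {1..} \<G>" and sim: "uf_sim \<F> \<G>"
    and A: "convex_set A" "A \<in> \<F>"
  shows "A \<in> \<G>"
proof (rule ccontr)
  assume "A \<notin> \<G>"
  have A_pos: "A \<subseteq> {1..}" and "A \<noteq> {}"
    using F A(2) unfolding ultrafilter_on_def by auto
  have up_pos: "up A \<subseteq> {1..}" by (auto simp: up_def)
  have A_up: "A \<subseteq> up A" using subset_up[OF A_pos] .
  have "up A \<subseteq> up (up A)" using subset_up[OF up_pos] .
  moreover have "up (up A) \<subseteq> up A" unfolding up_def using dvd_trans by blast
  ultimately have "up A \<in> upward_sets"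
    using up_pos A_up \<open>A \<noteq> {}\<close> by (auto simp: upward_sets_def)
  moreover have "up A \<in> \<F>"
    using ultrafilter_mono[OF F A(2) A_up up_pos] .
  ultimately have "up A \<in> \<G>"
    using sim by (auto simp: uf_sim_def uf_dvd_def)
  moreover have "{1..} - A \<in> \<G>"
    using ultrafilter_compl[OF G A_pos] \<open>A \<notin> \<G>\<close> by simp
  ultimately have "up A \<inter> ({1..} - A) \<in> \<G>"
    by (rule ultrafilter_Int[OF G])
  moreover have eq: "up A \<inter> ({1..} - A) = up A - A"
    using up_pos by blast
  ultimately have G': "up A - A \<in> \<G>" by simp
  then have "up A - A \<noteq> {}" using G unfolding ultrafilter_on_def by metis
  \<comment> \<open>If \<open>n\<close> were in \<open>A\<close>, convexity would pull
    \<open>m\<close>, caught between \<open>a\<close> and \<open>n\<close>, into \<open>A\<close>.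
    So \<open>up A - A\<close> is an upward set, and it passes from \<G> to \<F>, which already
    contains the disjoint set \<open>A\<close>.\<close>
  have "up (up A - A) \<subseteq> up A - A"
  proof
    fix n assume "n \<in> up (up A - A)"
    then obtain m a where m: "1 \<le> n" "m dvd n" "m \<notin> A" "a \<in> A" "a dvd m"
      by (auto simp: up_def)
    then have "n \<in> up A" using dvd_trans unfolding up_def by blast
    moreover have "n \<notin> A" using A(1) m unfolding convex_set_def by blast
    ultimately show "n \<in> up A - A" by blast
  qed
  moreover have "up A - A \<subseteq> up (up A - A)" using subset_up[of "up A - A"] up_pos by blast
  ultimately have "up A - A \<in> upward_sets"
    using \<open>up A - A \<noteq> {}\<close> up_pos by (auto simp: upward_sets_def)
  then have "up A - A \<in> \<F>"
    using G' sim by (auto simp: uf_sim_def uf_dvd_def)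
  then have "A \<inter> (up A - A) \<in> \<F>"
    by (rule ultrafilter_Int[OF F A(2)])
  then have "{} \<in> \<F>" by (simp add: Int_Diff)
  then show False using F by (simp add: ultrafilter_on_def)
qed

section \<open>Nonstandard powers and exact divisors\<close>

text \<open>For a prime power \<open>w\<close>, exactness means being coprime to the cofactor. Base
  and exponent are not mentioned, so exact divisors are single numbers instead of pairs and can be
  counted as a section.\<close>

definition exact_in :: "nat set \<Rightarrow> nat \<Rightarrow> nat \<Rightarrow> bool" where
  "exact_in A w n \<longleftrightarrow> w \<in> A \<and> w dvd n \<and> coprime w (n div w)"

lemma exact_in_iff:
  assumes "prime p" "1 \<le> a" "1 \<le> n"
  shows "exact_in prime_powers (p ^ a) n \<longleftrightarrow> (\<exists>m\<ge>1. n = p ^ a * m \<and> \<not> p dvd m)"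
proof
  have pos: "0 < p ^ a" using assms by (simp add: prime_gt_0_nat)
  have cop: "coprime (p ^ a) m \<longleftrightarrow> \<not> p dvd m" for m
    using assms by (simp add: coprime_power_left_iff prime_imp_coprime_nat prime_imp_coprime)
      (metis coprime_common_divisor dvd_refl not_prime_unit prime_imp_coprime)
  {
    assume "exact_in prime_powers (p ^ a) n"
    then have "p ^ a dvd n" and c: "coprime (p ^ a) (n div p ^ a)"
      by (simp_all add: exact_in_def)
    then obtain m where m: "n = p ^ a * m" by blast
    have "n div p ^ a = m" unfolding m using pos by simp
    then have "coprime (p ^ a) m" using c by simp
    moreover have "1 \<le> m" using m assms(3) by (cases m) simp_all
    ultimately show "\<exists>m\<ge>1. n = p ^ a * m \<and> \<not> p dvd m"
      using m cop by blast
  }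
  assume "\<exists>m\<ge>1. n = p ^ a * m \<and> \<not> p dvd m"
  then obtain m where "1 \<le> m" "n = p ^ a * m" "\<not> p dvd m" by blast
  moreover have "p ^ a \<in> prime_powers"
    using assms by (auto simp: prime_powers_def)
  ultimately show "exact_in prime_powers (p ^ a) n"
    using cop pos by (simp add: exact_in_def)
qed

lemma finite_exact_in: "1 \<le> n \<Longrightarrow> finite {w. 1 \<le> w \<and> exact_in A w n}"
  by (rule finite_subset[of _ "{..n}"]) (auto simp: exact_in_def intro: dvd_imp_le)

context nonstandard
begin

text \<open>Existence and uniqueness of values transfer within \<open>star_nat ext\<close>;
  \<open>star_rel3_dom\<close> extends uniqueness to all objects, over which the description
  ranges.\<close>

lemma binary_function_transfer:
  assumes f: "\<And>m n. 1 \<le> m \<Longrightarrow> 1 \<le> n \<Longrightarrow> 1 \<le> f m n" and xy: "x \<in> star_nat ext" "y \<in> star_nat ext"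
  shows "\<exists>!z. star_rel ext {[m, n, f m n] |m n. 1 \<le> m \<and> 1 \<le> n} [x, y, z]"
    and "(THE z. star_rel ext {[m, n, f m n] |m n. 1 \<le> m \<and> 1 \<le> n} [x, y, z]) \<in> star_nat ext"
    and "star_rel ext (rel3 (\<lambda>m n k. k = f m n)) [x, y, z] \<longleftrightarrow>
      (THE z. star_rel ext {[m, n, f m n] |m n. 1 \<le> m \<and> 1 \<le> n} [x, y, z]) = z"
proof -
  have eq: "{[m, n, f m n] |m n. 1 \<le> m \<and> 1 \<le> n} = rel3 (\<lambda>m n k. k = f m n)"
    using f by (auto simp: rel3_def)
  have "fsat {1..} (\<lambda>R xs. xs \<in> R) (\<lambda>_. 1) (FAll 0 (FAll 1 (FEx 2 (P3 (\<lambda>m n k. k = f m n) 0 1 2))))"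
    using f by simp
  from transfer_closed[OF this] have ex: "\<exists>z\<in>star_nat ext. star_rel ext (rel3 (\<lambda>m n k. k = f m n)) [x, y, z]"
    using xy by simp
  have "fsat {1..} (\<lambda>R xs. xs \<in> R) (\<lambda>_. 1) (FAll 0 (FAll 1 (FAll 2 (FAll 3
      (FImp (P3 (\<lambda>m n k. k = f m n) 0 1 2) (FImp (P3 (\<lambda>m n k. k = f m n) 0 1 3) (FEq 2 3)))))))"
    by simp
  from transfer_closed[OF this] have un: "z = z'"
    if "star_rel ext (rel3 (\<lambda>m n k. k = f m n)) [x, y, z]"
      "star_rel ext (rel3 (\<lambda>m n k. k = f m n)) [x, y, z']" for z z'
    using star_rel3_dom[OF that(1)] star_rel3_dom[OF that(2)] that xy by simp blast
  show ex1: "\<exists>!z. star_rel ext {[m, n, f m n] |m n. 1 \<le> m \<and> 1 \<le> n} [x, y, z]"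
    unfolding eq using ex un by blast
  from theI'[OF this] show "star_rel ext (rel3 (\<lambda>m n k. k = f m n)) [x, y, z] \<longleftrightarrow>
      (THE z. star_rel ext {[m, n, f m n] |m n. 1 \<le> m \<and> 1 \<le> n} [x, y, z]) = z"
    using un unfolding eq by blast
  from theI'[OF ex1] show "(THE z. star_rel ext {[m, n, f m n] |m n. 1 \<le> m \<and> 1 \<le> n} [x, y, z]) \<in> star_nat ext"
    unfolding eq using star_rel3_dom by blast
qed

lemma star_times_iff:
  assumes "x \<in> star_nat ext" "y \<in> star_nat ext"
  shows "star_times ext x y \<in> star_nat ext"
    and "star_rel ext (rel3 (\<lambda>m n k. k = m * n)) [x, y, z] \<longleftrightarrow> star_times ext x y = z"
  using binary_function_transfer[of "(*)", OF _ assms] unfolding star_times_def by simp_all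

lemma star_power_iff:
  assumes "x \<in> star_nat ext" "y \<in> star_nat ext"
  shows "star_power ext x y \<in> star_nat ext"
    and "star_rel ext (rel3 (\<lambda>m n k. k = m ^ n)) [x, y, z] \<longleftrightarrow> star_power ext x y = z"
  using binary_function_transfer[of "(^)", OF _ assms] unfolding star_power_def by simp_all

abbreviation star_primes :: "'w set" where
  "star_primes \<equiv> star_set ext {p. prime p}"

lemma primes_pos: "{p :: nat. prime p} \<subseteq> {1..}"
  by (auto simp: Suc_le_eq prime_gt_0_nat)

lemma star_primes_subset: "p \<in> star_primes \<Longrightarrow> p \<in> star_nat ext"
  using star_set_subset[OF primes_pos] by blast

lemma star_primes_iff: "p \<in> star_primes \<longleftrightarrow> star_rel ext (rel1 prime) [p]"
  using star_set_iff[OF primes_pos] by simp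

text \<open>The transfer of \<open>exact_in_iff\<close>.\<close>

lemma exact_divisor_iff:
  assumes "p \<in> star_primes" "a \<in> star_nat ext" "x \<in> star_nat ext"
  shows "exact_divisor ext p a x \<longleftrightarrow> star_power ext p a \<in> star_section (exact_in prime_powers) x"
proof -
  have p: "p \<in> star_nat ext" using star_primes_subset assms(1) .
  have "fsat {1..} (\<lambda>R xs. xs \<in> R) (\<lambda>_. 1) (FAll 0 (FAll 1 (FAll 2 (FAll 3
      (FImp (P1 prime 0) (FImp (P3 (\<lambda>m n k. k = m ^ n) 0 1 2)
        (FIff (P2 (exact_in prime_powers) 2 3)
          (FEx 4 (FAnd (P3 (\<lambda>m n k. k = m * n) 2 4 3) (FNot (P2 (dvd) 0 4)))))))))))"
    using exact_in_iff by (auto simp: Suc_le_eq Bex_def)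
  from transfer_closed[OF this] have "star_rel ext (rel2 (exact_in prime_powers)) [star_power ext p a, x] \<longleftrightarrow>
      (\<exists>x'\<in>star_nat ext. star_rel ext (rel3 (\<lambda>m n k. k = m * n)) [star_power ext p a, x', x] \<and>
        \<not> star_rel ext (rel2 (dvd)) [p, x'])"
    using assms p star_power_iff[OF p assms(2)] by (simp add: star_primes_iff)
  then show ?thesis
    using assms star_power_iff(1)[OF p assms(2)] star_times_iff(2)[OF star_power_iff(1)[OF p assms(2)]]
    unfolding exact_divisor_def star_section_def star_dvd_def rel2_def[symmetric] by auto
qed

text \<open>Together with \<open>star_power_surj\<close> this identifies the pairs
  \<open>(p, a)\<close> that a pattern counts with single nonstandard prime powers.\<close>

lemma star_power_inject:
  assumes "p \<in> star_primes" "q \<in> star_primes" "a \<in> star_nat ext" "b \<in> star_nat ext"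
    "star_power ext p a = star_power ext q b"
  shows "p = q \<and> a = b"
proof -
  have pq: "p \<in> star_nat ext" "q \<in> star_nat ext" using star_primes_subset assms by auto
  have *: "p = q \<and> a = b" if "prime p" "prime q" "1 \<le> a" "1 \<le> b" "p ^ a = q ^ b" for p q a b :: nat
    using prime_power_inj'[OF that(1,2,5)] that(3,4) by simp
  have "fsat {1..} (\<lambda>R xs. xs \<in> R) (\<lambda>_. 1) (FAll 0 (FAll 1 (FAll 2 (FAll 3 (FAll 4
      (FImp (P1 prime 0) (FImp (P1 prime 1) (FImp (P3 (\<lambda>m n k. k = m ^ n) 0 2 4)
        (FImp (P3 (\<lambda>m n k. k = m ^ n) 1 3 4) (FAnd (FEq 0 1) (FEq 2 3)))))))))))"
    unfolding fsat.simps fsat_derived by (intro ballI impI, rule *) simp_all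
  from transfer_closed[OF this] show ?thesis
    using assms pq star_power_iff[OF pq(1) assms(3)] star_power_iff[OF pq(2) assms(4)]
    by (simp add: star_primes_iff)
qed

lemma star_power_surj:
  assumes "w \<in> star_set ext prime_powers"
  shows "\<exists>p\<in>star_primes. \<exists>a\<in>star_nat ext. star_power ext p a = w"
proof -
  have "fsat {1..} (\<lambda>R xs. xs \<in> R) (\<lambda>_. 1) (FAll 0 (FImp (P1 (\<lambda>w. w \<in> prime_powers) 0)
      (FEx 1 (FEx 2 (FAnd (P1 prime 1) (P3 (\<lambda>m n k. k = m ^ n) 1 2 0))))))"
  proof (simp del: One_nat_def, intro ballI impI)
    fix w assume "w \<in> prime_powers"
    then show "\<exists>p\<in>{1..}. prime p \<and> (\<exists>a\<in>{1..}. w = p ^ a)"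
      using primes_pos unfolding prime_powers_def by blast
  qed
  from transfer_closed[OF this] have "\<forall>w\<in>star_nat ext. star_rel ext (rel1 (\<lambda>w. w \<in> prime_powers)) [w] \<longrightarrow>
      (\<exists>p\<in>star_nat ext. \<exists>a\<in>star_nat ext. p \<in> star_primes \<and> star_rel ext (rel3 (\<lambda>m n k. k = m ^ n)) [p, a, w])"
    by (simp add: star_primes_iff)
  moreover have "w \<in> star_nat ext" "star_rel ext (rel1 (\<lambda>w. w \<in> prime_powers)) [w]"
    using assms star_set_subset[OF prime_powers_pos] star_set_iff[OF prime_powers_pos] by auto
  ultimately show ?thesis using star_power_iff(2) by blast
qed

lemma star_power_in_exponentials:
  assumes "p \<in> star_primes" "a \<in> star_nat ext"
  shows "star_power ext p a \<in> star_set ext (exponentials D) \<longleftrightarrow> p \<in> star_set ext (D \<inter> {p. prime p})"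
proof -
  have p: "p \<in> star_nat ext" using star_primes_subset assms(1) .
  have D: "D \<inter> {p. prime p} \<subseteq> {1..}" "exponentials D \<subseteq> {1..}"
    using primes_pos exponentials_subset prime_powers_pos by blast+
  have "p ^ a \<in> exponentials D \<longleftrightarrow> p \<in> D \<and> prime p" if "prime p" "1 \<le> a" for p a
  proof
    assume "p ^ a \<in> exponentials D"
    then obtain q n where "p ^ a = q ^ n" "q \<in> D" "prime q" "1 \<le> n"
      unfolding exponentials_def by blast
    then show "p \<in> D \<and> prime p"
      using prime_power_inj'(1)[OF that(1), of q a n] that by simp
  qed (use that in \<open>unfold exponentials_def, blast\<close>)
  then have "fsat {1..} (\<lambda>R xs. xs \<in> R) (\<lambda>_. 1) (FAll 0 (FAll 1 (FAll 2
      (FImp (P1 prime 0) (FImp (P3 (\<lambda>m n k. k = m ^ n) 0 1 2)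
        (FIff (P1 (\<lambda>w. w \<in> exponentials D) 2) (P1 (\<lambda>p. p \<in> D \<inter> {p. prime p}) 0)))))))"
    by (simp add: Suc_le_eq)
  from transfer_closed[OF this] show ?thesis
    using assms p star_power_iff[OF p assms(2)] star_set_iff[OF D(1)] star_set_iff[OF D(2)]
    by (simp add: star_primes_iff)
qed

lemma star_power_in_prime_powers:
  assumes "p \<in> star_primes" "a \<in> star_nat ext"
  shows "star_power ext p a \<in> star_set ext prime_powers"
proof -
  have "exponentials UNIV = prime_powers"
    by (auto simp: exponentials_def prime_powers_def)
  then show ?thesis using star_power_in_exponentials[OF assms, of UNIV] assms by simp
qed

lemma star_section_exact_in:
  assumes "A \<subseteq> prime_powers" "x \<in> star_nat ext"
  shows "star_section (exact_in A) x = star_section (exact_in prime_powers) x \<inter> star_set ext A"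
proof -
  have "A \<subseteq> {1..}" using assms prime_powers_pos by blast
  note A = star_set_iff[OF this]
  have "fsat {1..} (\<lambda>R xs. xs \<in> R) (\<lambda>_. 1) (FAll 0 (FAll 1
      (FIff (P2 (exact_in A) 0 1) (FAnd (P2 (exact_in prime_powers) 0 1) (P1 (\<lambda>n. n \<in> A) 0)))))"
    using assms(1) by (auto simp: exact_in_def)
  from transfer_closed[OF this] show ?thesis
    using assms(2) by (auto simp: star_section_def A)
qed

end

lemma uf_sim_refl: "uf_sim \<F> \<F>"
  by (simp add: uf_sim_def uf_dvd_def)

lemma uf_sim_sym: "uf_sim \<F> \<G> \<Longrightarrow> uf_sim \<G> \<F>"
  by (simp add: uf_sim_def)

lemma uf_sim_trans: "uf_sim \<F> \<G> \<Longrightarrow> uf_sim \<G> \<H> \<Longrightarrow> uf_sim \<F> \<H>"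
  unfolding uf_sim_def uf_dvd_def by blast

context nonstandard
begin

section \<open>Basic classes\<close>

lemma tp_iff: "A \<in> tp ext x \<longleftrightarrow> A \<subseteq> {1..} \<and> x \<in> star_set ext A"
  by (simp add: tp_def)

lemma tp_ultrafilter_on: "x \<in> star_nat ext \<Longrightarrow> ultrafilter_on {1..} (tp ext x)"
  using tp_ultrafilter by (simp add: beta_nat_def)

lemma equiv_approx_rel: "equiv (power_pairs ext \<P>) (approx_rel ext \<P>)"
proof (rule equivI)
  show "refl_on (power_pairs ext \<P>) (approx_rel ext \<P>)"
    by (auto simp: refl_on_def approx_rel_def uf_sim_refl)
  show "sym (approx_rel ext \<P>)"
    by (auto simp: sym_def approx_rel_def intro: uf_sim_sym)
  show "trans (approx_rel ext \<P>)"
    by (auto simp: trans_def approx_rel_def intro: uf_sim_trans)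
qed (auto simp: approx_rel_def)

definition class_of :: "'w \<Rightarrow> 'w \<Rightarrow> nat set set set" where
  "class_of p a = basic_class ext (approx_rel ext (tp ext p) `` {(p, a)})"

lemma power_pairs_iff:
  "(p, a) \<in> power_pairs ext \<P> \<longleftrightarrow> p \<in> star_nat ext \<and> tp ext p = \<P> \<and> a \<in> star_nat ext"
  by (auto simp: power_pairs_def generates_def)

lemma tp_prime_ultrafilter:
  assumes "p \<in> star_nat ext"
  shows "tp ext p \<in> prime_ultrafilters \<longleftrightarrow> p \<in> star_primes"
  using tp_ultrafilter[OF assms] primes_pos by (simp add: prime_ultrafilters_def tp_iff)

text \<open>A pair lies in only one equivalence class, that of the relation belonging to the type of
  \<open>p\<close>. An equation thus replaces the choice of an ultrafilter and a class.\<close>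

lemma gen_basic_iff:
  "gen_basic ext p a B \<longleftrightarrow> p \<in> star_primes \<and> a \<in> star_nat ext \<and> B = class_of p a"
proof
  assume "gen_basic ext p a B"
  then obtain \<P> u where u: "\<P> \<in> prime_ultrafilters" "u \<in> exponent_classes ext \<P>"
      "B = basic_class ext u" "(p, a) \<in> u"
    by (auto simp: gen_basic_def)
  obtain z where z: "u = approx_rel ext \<P> `` {z}"
    using u(2) unfolding exponent_classes_def by (rule quotientE)
  have pa: "(z, (p, a)) \<in> approx_rel ext \<P>"
    using u(4) z by simp
  then have "(p, a) \<in> power_pairs ext \<P>"
    by (auto simp: approx_rel_def)
  then have p: "p \<in> star_nat ext" "tp ext p = \<P>" "a \<in> star_nat ext"
    by (simp_all add: power_pairs_iff)
  moreover have "u = approx_rel ext \<P> `` {(p, a)}"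
    using equiv_class_eq[OF equiv_approx_rel pa] z by simp
  ultimately show "p \<in> star_primes \<and> a \<in> star_nat ext \<and> B = class_of p a"
    using u(1,3) tp_prime_ultrafilter[OF p(1)] by (simp add: class_of_def)
next
  assume *: "p \<in> star_primes \<and> a \<in> star_nat ext \<and> B = class_of p a"
  then have p: "p \<in> star_nat ext" using star_primes_subset by blast
  then have pp: "(p, a) \<in> power_pairs ext (tp ext p)"
    using * by (simp add: power_pairs_iff)
  show "gen_basic ext p a B"
    unfolding gen_basic_def
  proof (intro bexI conjI)
    show "tp ext p \<in> prime_ultrafilters" using * tp_prime_ultrafilter[OF p] by simp
    show "B = basic_class ext (approx_rel ext (tp ext p) `` {(p, a)})"
      using * by (simp add: class_of_def)
    show "(p, a) \<in> approx_rel ext (tp ext p) `` {(p, a)}"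
      using equiv_class_self[OF equiv_approx_rel pp] .
    show "approx_rel ext (tp ext p) `` {(p, a)} \<in> exponent_classes ext (tp ext p)"
      using pp unfolding exponent_classes_def by (rule quotientI)
  qed
qed

lemma gen_basic_exists:
  assumes "B \<in> basic_classes ext"
  shows "\<exists>p a. gen_basic ext p a B"
proof -
  obtain u \<P> where u: "B = basic_class ext u" "\<P> \<in> prime_ultrafilters" "u \<in> exponent_classes ext \<P>"
    using assms by (auto simp: basic_classes_def)
  obtain z where "u = approx_rel ext \<P> `` {z}" "z \<in> power_pairs ext \<P>"
    using u(3) unfolding exponent_classes_def by (rule quotientE)
  then have "z \<in> u"
    using equiv_class_self[OF equiv_approx_rel] by simp
  then show ?thesis
    using u unfolding gen_basic_def by (cases z) blast
qed

lemma gen_basic_class: "gen_basic ext p a B \<Longrightarrow> B \<in> basic_classes ext"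
  by (auto simp: gen_basic_def basic_classes_def)

lemma class_of_eqI:
  assumes "p \<in> star_primes" "q \<in> star_primes" "a \<in> star_nat ext" "b \<in> star_nat ext" "tp ext p = tp ext q"
    "uf_sim (tp ext (star_power ext p a)) (tp ext (star_power ext q b))"
  shows "class_of p a = class_of q b"
proof -
  have "((p, a), (q, b)) \<in> approx_rel ext (tp ext p)"
    using assms star_primes_subset by (simp add: approx_rel_def power_pairs_iff)
  from equiv_class_eq[OF equiv_approx_rel this] show ?thesis
    using assms(5) by (simp add: class_of_def)
qed

text \<open>The members of a basic class are equivalent under \<open>uf_sim\<close>, and by
  \<open>convex_mem_sim\<close> convex sets do not distinguish equivalent ultrafilters. Hence one
  generator decides for the whole class.\<close>

lemma in_class_iff:
  assumes g: "gen_basic ext p a B" and A: "A \<in> convex_sets"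
  shows "in_class A B \<longleftrightarrow> star_power ext p a \<in> star_set ext A"
proof -
  have pa: "p \<in> star_primes" "a \<in> star_nat ext" "B = class_of p a"
    using g by (simp_all add: gen_basic_iff)
  have p: "p \<in> star_nat ext" using pa star_primes_subset by blast
  have A': "A \<subseteq> {1..}" "convex_set A" using A prime_powers_pos by (auto simp: convex_sets_def)
  have pp: "(p, a) \<in> power_pairs ext (tp ext p)"
    using p pa by (simp add: power_pairs_iff)
  have uf: "ultrafilter_on {1..} (tp ext (star_power ext p a))"
    using tp_ultrafilter_on star_power_iff(1)[OF p pa(2)] by blast
  show ?thesis
  proof
    assume "in_class A B"
    moreover have "(p, a) \<in> approx_rel ext (tp ext p) `` {(p, a)}"
      using equiv_class_self[OF equiv_approx_rel pp] .
    then have "tp ext (star_power ext p a) \<in> B"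
      unfolding pa(3) class_of_def basic_class_def by blast
    ultimately have "A \<in> tp ext (star_power ext p a)"
      unfolding in_class_def by blast
    then show "star_power ext p a \<in> star_set ext A"
      by (simp add: tp_iff)
  next
    assume A_in: "star_power ext p a \<in> star_set ext A"
    show "in_class A B"
      unfolding in_class_def
    proof
      fix \<F> assume "\<F> \<in> B"
      then obtain q b where qb: "\<F> = tp ext (star_power ext q b)" "((p, a), (q, b)) \<in> approx_rel ext (tp ext p)"
        unfolding pa(3) class_of_def basic_class_def by blast
      then have "(q, b) \<in> power_pairs ext (tp ext p)" and sim: "uf_sim (tp ext (star_power ext p a)) \<F>"
        by (auto simp: approx_rel_def)
      then have "ultrafilter_on {1..} \<F>"
        using qb(1) tp_ultrafilter_on star_power_iff(1) by (simp add: power_pairs_iff)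
      from convex_mem_sim[OF uf this sim A'(2)] show "A \<in> \<F>"
        using A_in A'(1) by (simp add: tp_iff)
    qed
  qed
qed

text \<open>For the converse \<open>p\<close> and \<open>a\<close> are compared with a generator
  \<open>q\<close>, \<open>b\<close> of \<open>B\<close>. Two things are needed, since
  \<open>approx_rel\<close> only relates pairs over the same ultrafilter: the powers have equivalent
  types, and the bases have equal types.\<close>

theorem gen_basic_iff_convex:
  assumes B: "B \<in> basic_classes ext" and p: "p \<in> star_primes" and a: "a \<in> star_nat ext"
  shows "gen_basic ext p a B \<longleftrightarrow> (\<forall>A\<in>convex_sets. in_class A B \<longrightarrow> star_power ext p a \<in> star_set ext A)"
proof
  assume "gen_basic ext p a B"
  then show "\<forall>A\<in>convex_sets. in_class A B \<longrightarrow> star_power ext p a \<in> star_set ext A"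
    using in_class_iff by blast
next
  assume H: "\<forall>A\<in>convex_sets. in_class A B \<longrightarrow> star_power ext p a \<in> star_set ext A"
  obtain q b where qb: "gen_basic ext q b B"
    using gen_basic_exists[OF B] by blast
  then have q: "q \<in> star_primes" "b \<in> star_nat ext" "B = class_of q b"
    by (simp_all add: gen_basic_iff)
  note N = star_primes_subset[OF p] star_primes_subset[OF q(1)]
  define F where "F = tp ext (star_power ext q b)"
  define G where "G = tp ext (star_power ext p a)"
  have uf: "ultrafilter_on {1..} F" "ultrafilter_on {1..} G"
    unfolding F_def G_def using tp_ultrafilter_on star_power_iff(1) N a q(2) by blast+
  have ne: "A \<noteq> {}" if "A \<in> F" for A
    using uf(1) that unfolding ultrafilter_on_def by metis
  have FG: "A \<in> G" if "A \<in> F" "A \<in> convex_sets" for A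
    using H in_class_iff[OF qb that(2)] that by (simp add: F_def G_def tp_iff)
  have PP: "prime_powers \<in> F" "prime_powers \<in> G"
    unfolding F_def G_def tp_iff
    using star_power_in_prime_powers p a q prime_powers_pos by blast+
  have sub: "V \<in> F \<longleftrightarrow> V \<in> G" if V: "V \<in> upward_sets" for V
  proof
    assume "V \<in> F"
    then have VF: "V \<inter> prime_powers \<in> F" using ultrafilter_Int[OF uf(1)] PP by blast
    then have "V \<inter> prime_powers \<in> G"
      using FG convex_upward_Int[OF V] ne by blast
    then show "V \<in> G"
      by (rule ultrafilter_mono[OF uf(2)]) (use V in \<open>auto simp: upward_sets_def\<close>)
  next
    \<comment> \<open>Convex sets are known to pass from \<open>F\<close> to \<open>G\<close> only.
      For the other direction the complement of \<open>V\<close> among the prime powers is used,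
      which is convex as well.\<close>
    assume "V \<in> G"
    show "V \<in> F"
    proof (rule ccontr)
      assume "V \<notin> F"
      then have "{1..} - V \<in> F"
        using ultrafilter_compl[OF uf(1), of V] V by (simp add: upward_sets_def)
      then have "prime_powers \<inter> ({1..} - V) \<in> F"
        by (rule ultrafilter_Int[OF uf(1) PP(1)])
      moreover have "prime_powers \<inter> ({1..} - V) = prime_powers - V"
        using prime_powers_pos by blast
      ultimately have "prime_powers - V \<in> F" by simp
      then have "prime_powers - V \<in> G"
        using FG convex_upward_Diff[OF V] ne by blast
      then have "V \<inter> (prime_powers - V) \<in> G"
        by (rule ultrafilter_Int[OF uf(2) \<open>V \<in> G\<close>])
      then show False using uf(2) unfolding ultrafilter_on_def by (simp add: Int_Diff)
    qed
  qed
  then have sim: "uf_sim G F"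
    unfolding uf_sim_def uf_dvd_def by blast
  \<comment> \<open>The sets \<open>exponentials A\<close> transport membership in a type from the
    base \<open>q\<close> to the base \<open>p\<close>.\<close>
  have "tp ext q \<subseteq> tp ext p"
  proof
    fix A assume A: "A \<in> tp ext q"
    then have "A \<inter> {p. prime p} \<in> tp ext q"
      using q(1) N star_set_Int[of A "{p. prime p}" q] primes_pos by (auto simp: tp_iff)
    then have "star_power ext q b \<in> star_set ext (exponentials A)"
      using star_power_in_exponentials[OF q(1,2)] by (simp add: tp_iff)
    then have "exponentials A \<in> F"
      using exponentials_subset prime_powers_pos unfolding F_def tp_iff by blast
    then have "exponentials A \<in> G"
      using FG convex_exponentials ne by blast
    then have "p \<in> star_set ext (A \<inter> {p. prime p})"
      using star_power_in_exponentials[OF p a] by (simp add: G_def tp_iff)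
    then show "A \<in> tp ext p"
      using star_set_mono[of "A \<inter> {p. prime p}" A] A by (auto simp: tp_iff)
  qed
  then have "tp ext q = tp ext p"
    by (rule ultrafilter_eqI[OF tp_ultrafilter_on tp_ultrafilter_on, OF N(2,1)])
  then have "class_of p a = class_of q b"
    using class_of_eqI p q a sim by (simp add: F_def G_def)
  then show "gen_basic ext p a B"
    using p a q by (simp add: gen_basic_iff)
qed

end

section \<open>Patterns as minima of counts\<close>

text \<open>Finite thresholds determine even \<infinity>, so cardinals can be compared through
  statements about standard numbers \<open>k\<close>.\<close>

lemma enat_leI:
  fixes c d :: enat
  assumes "\<And>k. enat k \<le> c \<Longrightarrow> enat k \<le> d"
  shows "c \<le> d"
proof (cases c)
  case (enat n)
  then show ?thesis using assms by simp
next
  case infinity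
  show ?thesis
  proof (cases d)
    case (enat m)
    then show ?thesis using assms[of "Suc m"] infinity by simp
  qed simp
qed

lemma enat_eqI:
  fixes c d :: enat
  assumes "\<And>k. enat k \<le> c \<longleftrightarrow> enat k \<le> d"
  shows "c = d"
  by (rule antisym) (rule enat_leI, simp add: assms)+

definition count_set :: "nat set \<Rightarrow> nat \<Rightarrow> nat set" where
  "count_set A k = {n. 1 \<le> n \<and> k \<le> section_card (exact_in A) n}"

text \<open>The number of exact divisors in \<open>*A\<close> of any generator of \<open>\<G>\<close>.\<close>

definition uf_count :: "nat set set \<Rightarrow> nat set \<Rightarrow> enat" where
  "uf_count \<G> A = (THE c. \<forall>k. enat k \<le> c \<longleftrightarrow> count_set A k \<in> \<G>)"

text \<open>The index set of the minimum in the theorem.\<close>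

definition class_sets :: "nat set set set \<Rightarrow> nat set set" where
  "class_sets B = {A \<in> convex_sets. in_class A B}"

lemma enat_image_has_min:
  fixes f :: "'b \<Rightarrow> enat"
  assumes "K \<noteq> {}"
  shows "\<exists>a\<in>K. \<forall>b\<in>K. f a \<le> f b"
proof -
  obtain b where "b \<in> K" using assms by blast
  then have "\<exists>m. m \<in> f ` K" by blast
  then have "(LEAST m. m \<in> f ` K) \<in> f ` K" by (rule LeastI_ex)
  then obtain a where a: "a \<in> K" "f a = (LEAST m. m \<in> f ` K)" by force
  then have "\<forall>b\<in>K. f a \<le> f b" by (simp add: Least_le)
  then show ?thesis using a(1) by blast
qed

lemma Sigma_eqpoll_Union:
  assumes eq: "\<And>b. b \<in> S \<Longrightarrow> X b \<approx> Y b"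
    and disj: "\<And>b b'. b \<in> S \<Longrightarrow> b' \<in> S \<Longrightarrow> b \<noteq> b' \<Longrightarrow> Y b \<inter> Y b' = {}"
  shows "Sigma S X \<approx> (\<Union>b\<in>S. Y b)"
proof -
  have "\<exists>g. bij_betw g (X b) (Y b)" if "b \<in> S" for b
    using eq[OF that] by (simp add: eqpoll_def)
  then obtain g where g: "\<And>b. b \<in> S \<Longrightarrow> bij_betw (g b) (X b) (Y b)"
    by metis
  have "bij_betw (\<lambda>(b, z). g b z) (Sigma S X) (\<Union>b\<in>S. Y b)"
  proof (rule bij_betw_imageI)
    show "inj_on (\<lambda>(b, z). g b z) (Sigma S X)"
    proof (rule inj_onI, clarsimp)
      fix b z b' z'
      assume *: "b \<in> S" "z \<in> X b" "b' \<in> S" "z' \<in> X b'" "g b z = g b' z'"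
      have "g b z \<in> Y b" "g b' z' \<in> Y b'"
        using * bij_betwE[OF g] by blast+
      then have "b = b'" using disj[OF *(1,3)] *(5) by auto
      moreover from this have "z = z'"
        using bij_betw_imp_inj_on[OF g[OF *(1)]] * by (auto dest: inj_onD)
      ultimately show "b = b' \<and> z = z'" by simp
    qed
    have "g b ` X b = Y b" if "b \<in> S" for b
      using g[OF that] by (rule bij_betw_imp_surj_on)
    then show "(\<lambda>(b, z). g b z) ` Sigma S X = (\<Union>b\<in>S. Y b)"
      by force
  qed
  then show ?thesis unfolding eqpoll_def by blast
qed

context nonstandard
begin

lemma uf_count_generated:
  assumes "generates ext x \<G>"
  shows has_card_exact: "has_card ext (star_section (exact_in A) x) (uf_count \<G> A)"
    and uf_count_iff_generated: "enat k \<le> uf_count \<G> A \<longleftrightarrow> count_set A k \<in> \<G>"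
proof -
  have x: "x \<in> star_nat ext" "tp ext x = \<G>" using assms by (simp_all add: generates_def)
  have "count_set A k \<in> \<G> \<longleftrightarrow> star_rel ext (rel1 (\<lambda>n. k \<le> section_card (exact_in A) n)) [x]" for k
    unfolding rel1_positive x(2)[symmetric] tp_iff count_set_def by auto
  then obtain c where c: "has_card ext (star_section (exact_in A) x) c"
      "\<forall>k. enat k \<le> c \<longleftrightarrow> count_set A k \<in> \<G>"
    using star_section_card[where T = "exact_in A", OF finite_exact_in x(1)] by auto
  have "uf_count \<G> A = c"
    unfolding uf_count_def
  proof (rule the_equality)
    fix d assume "\<forall>k. enat k \<le> d \<longleftrightarrow> count_set A k \<in> \<G>"
    then show "d = c" using c(2) by (intro enat_eqI) simp
  qed (rule c(2))
  then show "has_card ext (star_section (exact_in A) x) (uf_count \<G> A)"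
    "enat k \<le> uf_count \<G> A \<longleftrightarrow> count_set A k \<in> \<G>"
    using c by simp_all
qed

lemma uf_count_iff: "\<G> \<in> beta_nat \<Longrightarrow> enat k \<le> uf_count \<G> A \<longleftrightarrow> count_set A k \<in> \<G>"
  using ultrafilter_generated uf_count_iff_generated by blast

text \<open>What the pattern counts at \<open>B\<close>, with prime powers for pairs and convex sets
  for \<open>gen_basic\<close>; see \<open>power_in_class_section\<close>.\<close>

definition class_section :: "nat set set set \<Rightarrow> 'w \<Rightarrow> 'w set" where
  "class_section B x = {w \<in> star_section (exact_in prime_powers) x. \<forall>A\<in>class_sets B. w \<in> star_set ext A}"

lemma exact_section_cases:
  assumes "x \<in> star_nat ext" "w \<in> star_section (exact_in prime_powers) x"
  obtains p a where "p \<in> star_primes" "a \<in> star_nat ext" "w = star_power ext p a"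
  using star_section_exact_in[OF subset_refl assms(1)] assms(2) star_power_surj by blast

lemma power_in_class_section:
  assumes "B \<in> basic_classes ext" "p \<in> star_primes" "a \<in> star_nat ext" "x \<in> star_nat ext"
  shows "star_power ext p a \<in> class_section B x \<longleftrightarrow> gen_basic ext p a B \<and> exact_divisor ext p a x"
  using gen_basic_iff_convex[OF assms(1-3)] exact_divisor_iff[OF assms(2-4)]
  unfolding class_section_def class_sets_def by blast

lemma exact_pairs_eqpoll:
  assumes B: "B \<in> basic_classes ext" and x: "x \<in> star_nat ext"
  shows "{(p, a). gen_basic ext p a B \<and> exact_divisor ext p a x} \<approx> class_section B x"
proof -
  have "bij_betw (\<lambda>(p, a). star_power ext p a)
      {(p, a). gen_basic ext p a B \<and> exact_divisor ext p a x} (class_section B x)"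
  proof (rule bij_betw_imageI)
    show "inj_on (\<lambda>(p, a). star_power ext p a) {(p, a). gen_basic ext p a B \<and> exact_divisor ext p a x}"
      by (rule inj_onI) (use star_power_inject in \<open>force simp: gen_basic_iff\<close>)
    show "(\<lambda>(p, a). star_power ext p a) ` {(p, a). gen_basic ext p a B \<and> exact_divisor ext p a x} =
        class_section B x"
    proof (intro antisym subsetI)
      fix w assume w: "w \<in> class_section B x"
      then have "w \<in> star_section (exact_in prime_powers) x" by (simp add: class_section_def)
      from exact_section_cases[OF x this] obtain p a
        where pa: "p \<in> star_primes" "a \<in> star_nat ext" "w = star_power ext p a" .
      then have "gen_basic ext p a B \<and> exact_divisor ext p a x"
        using power_in_class_section[OF B pa(1,2) x] w by simp
      then show "w \<in> (\<lambda>(p, a). star_power ext p a) ` {(p, a). gen_basic ext p a B \<and> exact_divisor ext p a x}"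
        using pa(3) by force
    next
      fix w assume "w \<in> (\<lambda>(p, a). star_power ext p a) ` {(p, a). gen_basic ext p a B \<and> exact_divisor ext p a x}"
      then obtain p a where pa: "w = star_power ext p a" "gen_basic ext p a B" "exact_divisor ext p a x"
        by auto
      then have "p \<in> star_primes" "a \<in> star_nat ext" by (simp_all add: gen_basic_iff)
      from power_in_class_section[OF B this x] show "w \<in> class_section B x"
        using pa by simp
    qed
  qed
  then show ?thesis unfolding eqpoll_def by blast
qed

text \<open>A generator of \<open>B\<close> lies in both extensions. Hence the intersection is
  nonempty, as members of \<open>convex_sets\<close> must be.\<close>

lemma class_sets_Int:
  assumes B: "B \<in> basic_classes ext" and "A \<in> class_sets B" "A' \<in> class_sets B"
  shows "A \<inter> A' \<in> class_sets B"
proof -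
  obtain p a where g: "gen_basic ext p a B" using gen_basic_exists[OF B] by blast
  have A: "A \<in> convex_sets" "A' \<in> convex_sets" "in_class A B" "in_class A' B"
    using assms by (simp_all add: class_sets_def)
  then have pos: "A \<subseteq> {1..}" "A' \<subseteq> {1..}" using prime_powers_pos by (auto simp: convex_sets_def)
  have pa: "p \<in> star_nat ext" "a \<in> star_nat ext" using g star_primes_subset by (auto simp: gen_basic_iff)
  have *: "star_power ext p a \<in> star_set ext (A \<inter> A')"
    using in_class_iff[OF g A(1)] in_class_iff[OF g A(2)] A(3,4)
      star_set_Int[OF pos star_power_iff(1)[OF pa]] by simp
  then have "A \<inter> A' \<in> convex_sets"
    using A(1,2) star_set_empty by (intro convex_sets_Int) auto
  then show ?thesis using * in_class_iff[OF g] by (simp add: class_sets_def)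
qed

lemma prime_powers_class_sets:
  assumes "B \<in> basic_classes ext"
  shows "prime_powers \<in> class_sets B"
proof -
  obtain p a where g: "gen_basic ext p a B" using gen_basic_exists[OF assms] by blast
  then have "star_power ext p a \<in> star_set ext prime_powers"
    using star_power_in_prime_powers by (simp add: gen_basic_iff)
  then show ?thesis
    using in_class_iff[OF g prime_powers_convex] prime_powers_convex by (simp add: class_sets_def)
qed

text \<open>\<open>L\<close> is not confined to \<open>class_sets B\<close> because the saturation
  argument mixes these sets with indices of another kind.\<close>

lemma class_sets_finite_lower:
  assumes B: "B \<in> basic_classes ext" and "finite L"
  shows "\<exists>A\<in>class_sets B. \<forall>A'\<in>L \<inter> class_sets B. A \<subseteq> A'"
  using assms(2)
proof (induction L rule: finite_induct)
  case empty
  then show ?case using prime_powers_class_sets[OF B] by blast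
next
  case (insert A0 L)
  then obtain A where A: "A \<in> class_sets B" "\<forall>A'\<in>L \<inter> class_sets B. A \<subseteq> A'" by blast
  show ?case
  proof (cases "A0 \<in> class_sets B")
    case True
    then show ?thesis using A class_sets_Int[OF B A(1) True] by (intro bexI[of _ "A \<inter> A0"]) auto
  next
    case False
    then show ?thesis using A by (intro bexI[of _ A]) auto
  qed
qed

text \<open>The middle set may be external. A finite \<open>c\<close> forces \<open>S = T\<close>;
  for \<infinity> the outer sets are equipollent and Schroeder-Bernstein applies.\<close>

lemma has_card_between:
  assumes "S \<subseteq> M" "M \<subseteq> T" "has_card ext S d" "has_card ext T c" "c \<le> d"
  shows "has_card ext M c"
proof (cases c)
  case (enat n)
  then have T: "finite T" "card T = n" using assms(4) by (simp_all add: has_card_def)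
  then have S: "finite S" "card S \<le> n"
    using assms(1,2) finite_subset card_mono[of T S] by (auto dest: subset_trans)
  obtain m where "d = enat m" "card S = m"
    using assms(3) S(1) has_card_unique[of S d "enat (card S)"] by (auto simp: has_card_def)
  then have "S = T"
    using T S assms(1,2,5) enat by (intro card_subset_eq) auto
  then show ?thesis using assms by auto
next
  case infinity
  then have "S \<approx> T"
    using assms(3-5) has_card_imp_eqpoll[of S \<infinity> T] by simp
  then have "T \<lesssim> M"
    using assms(1) by (meson eqpoll_sym eqpoll_imp_lepoll lepoll_trans subset_imp_lepoll)
  moreover have "M \<lesssim> T"
    using assms(2) by (rule subset_imp_lepoll)
  ultimately have "T \<approx> M" by (rule lepoll_antisym)
  then show ?thesis using has_card_eqpoll assms(4) by blast
qed

lemma transfer_implication: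
  assumes "\<And>m n. 1 \<le> m \<Longrightarrow> 1 \<le> n \<Longrightarrow> P n \<Longrightarrow> R m n \<Longrightarrow> S m n"
    and "x \<in> star_nat ext" "y \<in> star_nat ext" "star_rel ext (rel1 P) [x]" "star_rel ext (rel2 R) [y, x]"
  shows "star_rel ext (rel2 S) [y, x]"
proof -
  have "fsat {1..} (\<lambda>R xs. xs \<in> R) (\<lambda>_. 1) (FAll 0 (FAll 1 (FImp (P1 P 0) (FImp (P2 R 1 0) (P2 S 1 0)))))"
    using assms(1) by simp
  from transfer_closed[OF this] show ?thesis using assms(2-) by simp
qed

text \<open>The upper bound is the section of \<open>A0\<close>. For the lower bound, finitely many
  requirements are met by the set of all exact divisors in one small \<open>A\<close>, which is
  large enough by the minimality of \<open>A0\<close>; saturation meets all requirements at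
  once.\<close>

theorem class_section_card:
  assumes B: "B \<in> basic_classes ext" and x: "generates ext x \<G>"
    and A0: "A0 \<in> class_sets B" "\<forall>A\<in>class_sets B. uf_count \<G> A0 \<le> uf_count \<G> A"
  shows "has_card ext (class_section B x) (uf_count \<G> A0)"
proof -
  define c where "c = uf_count \<G> A0"
  have xN: "x \<in> star_nat ext" "tp ext x = \<G>" using x by (simp_all add: generates_def)
  \<comment> \<open>The binary digits of a number code a finite set, so a hyperfinite set becomes a
    single element that saturation can produce.\<close>
  define D where "D w y \<longleftrightarrow> w \<in> set_decode y" for w y
  have D_fin: "finite {w. 1 \<le> w \<and> D w y}" for y
    unfolding D_def by (rule finite_subset[OF _ finite_set_decode[of y]]) blast
  \<comment> \<open>The requirements on a code \<open>y\<close> of a hyperfinite subset of \<open>class_section B x\<close> are indexed by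
    \<open>A \<in> class_sets B\<close> (the coded set consists of exact divisors in \<open>A\<close>) and by the sets \<open>{..k}\<close>
    (it has at least \<open>k\<close> elements); only the latter contain 0.\<close>
  define P where "P S y n \<longleftrightarrow> (if 0 \<in> S then card S \<le> Suc (section_card D y)
    else \<forall>w\<ge>1. D w y \<longrightarrow> exact_in S w n)" for S y n
  define J where "J = class_sets B \<union> atMost ` {k. enat k \<le> c}"
  have no0: "0 \<notin> A" if "A \<in> class_sets B" for A
    using that prime_powers_pos unfolding class_sets_def convex_sets_def by fastforce
  have pp: "A \<subseteq> prime_powers" if "A \<in> class_sets B" for A
    using that by (simp add: class_sets_def convex_sets_def)
  have "\<exists>y\<in>star_nat ext. \<forall>S\<in>J. star_rel ext (rel2 (P S)) [y, x]"
  proof (rule saturation[OF _ xN(1)])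
    \<comment> \<open>Both kinds of requirement are indexed by sets of numbers, which keeps
      \<open>J\<close> within the continuum.\<close>
    show "J \<lesssim> (UNIV :: nat set set)"
      by (rule subset_imp_lepoll) simp
  next
    fix L assume L: "finite L" "L \<subseteq> J"
    obtain A where A: "A \<in> class_sets B" "\<forall>A'\<in>L \<inter> class_sets B. A \<subseteq> A'"
      using class_sets_finite_lower[OF B L(1)] by blast
    define ks where "ks = {k. enat k \<le> c \<and> {..k} \<in> L}"
    have "finite (atMost ` ks)"
      by (rule finite_subset[OF _ L(1)]) (auto simp: ks_def)
    then have ks: "finite ks"
      by (rule finite_imageD) (auto simp: inj_on_def)
    \<comment> \<open>The 0 covers the case that \<open>L\<close> contains no requirement on the
      number of elements.\<close>
    define m where "m = Max (insert 0 ks)"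
    have "m \<in> insert 0 ks" unfolding m_def using ks by (intro Max_in) auto
    then have "enat m \<le> c" by (auto simp: ks_def zero_enat_def[symmetric])
    have m_max: "k \<le> m" if "k \<in> ks" for k
      unfolding m_def using ks that by (intro Max_ge) auto
    have "enat m \<le> uf_count \<G> A"
      using \<open>enat m \<le> c\<close> A0(2) A(1) order_trans unfolding c_def by blast
    then have "count_set A m \<in> \<G>"
      using uf_count_iff_generated[OF x] by simp
    then have many: "star_rel ext (rel1 (\<lambda>n. m \<le> section_card (exact_in A) n)) [x]"
      unfolding rel1_positive xN(2)[symmetric] tp_iff count_set_def by simp
    \<comment> \<open>The witness codes all exact divisors in \<open>A\<close>, the common lower
      bound of the class sets in \<open>L\<close>.\<close>
    define R where "R y n \<longleftrightarrow> (\<forall>w\<ge>1. D w y \<longleftrightarrow> exact_in A w n)" for y n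
    have "fsat {1..} (\<lambda>R xs. xs \<in> R) (\<lambda>_. 1) (FAll 0 (FEx 1 (P2 R 1 0)))"
    proof (simp del: One_nat_def, intro ballI)
      fix n :: nat assume "n \<in> {1..}"
      then have fin: "finite {w. 1 \<le> w \<and> exact_in A w n}" using finite_exact_in by simp
      \<comment> \<open>Adding 0 to the coded set makes the code odd and hence positive; sections
        consist of positive elements, so they are unaffected.\<close>
      define y where "y = set_encode (insert 0 {w. 1 \<le> w \<and> exact_in A w n})"
      have dec: "set_decode y = insert 0 {w. 1 \<le> w \<and> exact_in A w n}"
        unfolding y_def by (rule set_encode_inverse) (use fin in simp)
      then have "odd y" using set_decode_0[of y] by simp
      then have "1 \<le> y" by (cases y) simp_all
      moreover have "R y n" by (auto simp: R_def D_def dec)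
      ultimately show "\<exists>y\<in>{1..}. R y n" by auto
    qed
    from transfer_closed[OF this] obtain y where y: "y \<in> star_nat ext" "star_rel ext (rel2 R) [y, x]"
      using xN(1) by auto
    have "star_rel ext (rel2 (P S)) [y, x]" if S: "S \<in> L" for S
    proof (rule transfer_implication[OF _ xN(1) y(1) many y(2)])
      fix y n :: nat assume *: "1 \<le> y" "1 \<le> n" "m \<le> section_card (exact_in A) n" "R y n"
      consider "S \<in> class_sets B" | k where "S = {..k}" "enat k \<le> c"
        using S L(2) unfolding J_def by blast
      then show "P S y n"
      proof cases
        case 1
        then have "A \<subseteq> S" using A(2) S by blast
        then show ?thesis using no0[OF 1] * by (auto simp: P_def R_def exact_in_def)
      next
        case 2
        have "section_card D y = section_card (exact_in A) n"
          unfolding section_card_def using * by (intro arg_cong[where f = card]) (auto simp: R_def)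
        moreover have "k \<le> m" using m_max 2 S by (simp add: ks_def)
        \<comment> \<open>The set \<open>{..k}\<close> has \<open>Suc k\<close> elements, which
          accounts for the \<open>Suc\<close> in \<open>P\<close>.\<close>
        ultimately show ?thesis using 2 * by (simp add: P_def)
      qed
    qed
    then show "\<exists>y\<in>star_nat ext. \<forall>S\<in>L. star_rel ext (rel2 (P S)) [y, x]"
      using y(1) by blast
  qed
  then obtain y where y: "y \<in> star_nat ext" "\<forall>S\<in>J. star_rel ext (rel2 (P S)) [y, x]"
    by blast
  have sub: "star_section D y \<subseteq> star_section (exact_in A) x" if A: "A \<in> class_sets B" for A
  proof
    fix w assume w: "w \<in> star_section D y"
    have "fsat {1..} (\<lambda>R xs. xs \<in> R) (\<lambda>_. 1)
        (FAll 0 (FAll 1 (FAll 2 (FImp (P2 (P A) 1 0) (FImp (P2 D 2 1) (P2 (exact_in A) 2 0))))))"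
      using no0[OF A] by (simp add: P_def)
    from transfer_closed[OF this] show "w \<in> star_section (exact_in A) x"
      using w xN(1) y A by (simp add: star_section_def J_def)
  qed
  have "star_section D y \<subseteq> class_section B x"
    unfolding class_section_def
    using sub sub[OF prime_powers_class_sets[OF B]] star_section_exact_in[OF pp xN(1)] by blast
  moreover have "class_section B x \<subseteq> star_section (exact_in A0) x"
    unfolding class_section_def star_section_exact_in[OF pp[OF A0(1)] xN(1)] using A0(1) by blast
  moreover obtain d where d: "has_card ext (star_section D y) d"
      "\<forall>k. enat k \<le> d \<longleftrightarrow> star_rel ext (rel1 (\<lambda>n. k \<le> section_card D n)) [y]"
    using star_section_card[where T = D, OF D_fin y(1)] by blast
  moreover have "c \<le> d"
  proof -
    have "enat k \<le> d" if k: "enat k \<le> c" for k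
    proof -
      have "fsat {1..} (\<lambda>R xs. xs \<in> R) (\<lambda>_. 1)
          (FAll 0 (FAll 1 (FImp (P2 (P {..k}) 1 0) (P1 (\<lambda>n. k \<le> section_card D n) 1))))"
        by (simp add: P_def)
      from transfer_closed[OF this] show ?thesis
        using xN(1) y d(2) k by (simp add: J_def)
    qed
    then show ?thesis by (rule enat_leI)
  qed
  ultimately show ?thesis
    using has_card_between[OF _ _ d(1) has_card_exact[OF x]] unfolding c_def by blast
qed

text \<open>The minimum is attained as \<open>enat\<close> is well-ordered, and it depends on \<G>
  alone. So all generators share one pattern value, as the description in \<open>uf_pattern\<close>
  requires.\<close>

theorem uf_pattern_min:
  assumes B: "B \<in> basic_classes ext" and G: "\<G> \<in> beta_nat"
  shows "\<exists>A\<in>class_sets B. uf_pattern ext \<G> B = uf_count \<G> A \<and> (\<forall>A'\<in>class_sets B. uf_count \<G> A \<le> uf_count \<G> A')"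
    and "generates ext x \<G> \<Longrightarrow> has_card ext (class_section B x) (uf_pattern ext \<G> B)"
proof -
  obtain A where A: "A \<in> class_sets B" "\<forall>A'\<in>class_sets B. uf_count \<G> A \<le> uf_count \<G> A'"
    using enat_image_has_min[of "class_sets B" "uf_count \<G>"] prime_powers_class_sets[OF B] by blast
  have "pattern ext x B = uf_count \<G> A" if x: "generates ext x \<G>" for x
  proof -
    have "class_section B x \<approx> {(p, a). gen_basic ext p a B \<and> exact_divisor ext p a x}"
      using exact_pairs_eqpoll[OF B] x eqpoll_sym unfolding generates_def by blast
    then show ?thesis
      unfolding pattern_def
      using cardinal_eqI has_card_eqpoll class_section_card[OF B x A] by blast
  qed
  moreover obtain x0 where "generates ext x0 \<G>" using ultrafilter_generated[OF G] by blast
  ultimately have eq: "uf_pattern ext \<G> B = uf_count \<G> A"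
    unfolding uf_pattern_def by (intro the_equality) auto
  then show "\<exists>A\<in>class_sets B. uf_pattern ext \<G> B = uf_count \<G> A \<and> (\<forall>A'\<in>class_sets B. uf_count \<G> A \<le> uf_count \<G> A')"
    using A by blast
  show "generates ext x \<G> \<Longrightarrow> has_card ext (class_section B x) (uf_pattern ext \<G> B)"
    unfolding eq using class_section_card[OF B _ A] by blast
qed

theorem cardinal_sum_closure:
  assumes A: "A \<in> convex_sets" and G: "\<G> \<in> beta_nat"
  shows "cardinal_sum ext (closure_classes ext A) (uf_pattern ext \<G>) = uf_count \<G> A"
proof -
  obtain x where x: "generates ext x \<G>" using ultrafilter_generated[OF G] by blast
  then have xN: "x \<in> star_nat ext" by (simp add: generates_def)
  have App: "A \<subseteq> prime_powers" using A by (simp add: convex_sets_def)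
  let ?S = "closure_classes ext A"
  have S: "B \<in> basic_classes ext" "A \<in> class_sets B" if "B \<in> ?S" for B
    using that A by (simp_all add: closure_classes_def class_sets_def)
  have sec: "has_card ext (class_section B x) (uf_pattern ext \<G> B)" if "B \<in> ?S" for B
    using uf_pattern_min(2)[OF S(1)[OF that] G x] .
  have disj: "class_section B x \<inter> class_section B' x = {}" if "B \<in> ?S" "B' \<in> ?S" "B \<noteq> B'" for B B'
  proof (rule ccontr)
    assume "class_section B x \<inter> class_section B' x \<noteq> {}"
    then obtain w where w: "w \<in> class_section B x" "w \<in> class_section B' x" by blast
    then have "w \<in> star_section (exact_in prime_powers) x" by (simp add: class_section_def)
    from exact_section_cases[OF xN this] obtain p a
      where pa: "p \<in> star_primes" "a \<in> star_nat ext" "w = star_power ext p a" .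
    then show False
      using power_in_class_section[OF S(1) pa(1,2) xN] w that by (auto simp: gen_basic_iff)
  qed
  have union: "(\<Union>B\<in>?S. class_section B x) = star_section (exact_in A) x"
  proof (intro antisym subsetI)
    fix w assume "w \<in> (\<Union>B\<in>?S. class_section B x)"
    then show "w \<in> star_section (exact_in A) x"
      using S(2) unfolding class_section_def star_section_exact_in[OF App xN] by blast
  next
    fix w assume "w \<in> star_section (exact_in A) x"
    then have w: "w \<in> star_section (exact_in prime_powers) x" "w \<in> star_set ext A"
      unfolding star_section_exact_in[OF App xN] by simp_all
    from exact_section_cases[OF xN w(1)] obtain p a
      where pa: "p \<in> star_primes" "a \<in> star_nat ext" "w = star_power ext p a" .
    \<comment> \<open>Each exact divisor in the extension of \<open>A\<close> lies in the section of
      the class that it generates.\<close>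
    then have g: "gen_basic ext p a (class_of p a)" by (simp add: gen_basic_iff)
    then have "class_of p a \<in> ?S"
      using in_class_iff[OF g A] w pa gen_basic_class by (simp add: closure_classes_def)
    moreover have "w \<in> class_section (class_of p a) x"
      using power_in_class_section[OF gen_basic_class[OF g] pa(1,2) xN] g w(1)
        exact_divisor_iff[OF pa(1,2) xN] pa(3) by simp
    ultimately show "w \<in> (\<Union>B\<in>?S. class_section B x)" by blast
  qed
  have sum: "has_card ext (Sigma ?S X) (uf_count \<G> A)"
    if X: "\<forall>B\<in>?S. has_card ext (X B) (uf_pattern ext \<G> B)" for X :: "nat set set set \<Rightarrow> 'w set"
  proof -
    have "Sigma ?S X \<approx> (\<Union>B\<in>?S. class_section B x)"
      by (rule Sigma_eqpoll_Union[OF _ disj]) (use has_card_imp_eqpoll X sec in blast)+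
    then have "star_section (exact_in A) x \<approx> Sigma ?S X"
      unfolding union by (rule eqpoll_sym)
    then show ?thesis using has_card_eqpoll has_card_exact[OF x] by blast
  qed
  show ?thesis
    unfolding cardinal_sum_def
  proof (rule the_equality)
    show "\<forall>X :: nat set set set \<Rightarrow> 'w set. (\<forall>b\<in>?S. has_card ext (X b) (uf_pattern ext \<G> b)) \<longrightarrow>
        has_card ext (Sigma ?S X) (uf_count \<G> A)"
      using sum by blast
  next
    fix k assume k: "\<forall>X :: nat set set set \<Rightarrow> 'w set. (\<forall>b\<in>?S. has_card ext (X b) (uf_pattern ext \<G> b)) \<longrightarrow>
        has_card ext (Sigma ?S X) k"
    \<comment> \<open>The class sections realise the given cardinals. With no such family the
      condition on \<open>k\<close> would be vacuous and its solution not unique.\<close>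
    have X: "\<forall>b\<in>?S. has_card ext (class_section b x) (uf_pattern ext \<G> b)"
      using sec by simp
    show "k = uf_count \<G> A"
      by (rule has_card_unique[OF k[rule_format, OF X[rule_format]] sum[OF X]])
  qed
qed

end

section \<open>Limits along an ultrafilter\<close>

text \<open>A finite \<open>n\<close> is isolated by the thresholds \<open>n\<close> and
  \<open>Suc n\<close>; every neighborhood of \<infinity> contains a tail.\<close>

lemma has_Hlim_enatI:
  assumes H: "ultrafilter_on I \<H>" and y: "\<And>k. {i \<in> I. enat k \<le> f i} \<in> \<H> \<longleftrightarrow> enat k \<le> y"
  shows "has_Hlim I \<H> f y"
  unfolding has_Hlim_def
proof (intro allI impI, elim conjE)
  fix D :: "enat set" assume D: "open D" "y \<in> D"
  show "{i \<in> I. f i \<in> D} \<in> \<H>"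
  proof (cases y)
    case (enat n)
    have "{i \<in> I. enat n \<le> f i} \<in> \<H>" "I - {i \<in> I. enat (Suc n) \<le> f i} \<in> \<H>"
      using y enat ultrafilter_compl[OF H, of "{i \<in> I. enat (Suc n) \<le> f i}"] by auto
    then have "{i \<in> I. enat n \<le> f i} \<inter> (I - {i \<in> I. enat (Suc n) \<le> f i}) \<in> \<H>"
      by (rule ultrafilter_Int[OF H])
    moreover have "f i = enat n" if "enat n \<le> f i" "\<not> enat (Suc n) \<le> f i" for i
      using that by (cases "f i") auto
    then have "f i \<in> D" if "enat n \<le> f i" "\<not> enat (Suc n) \<le> f i" for i
      using D(2) enat that by metis
    then have "{i \<in> I. enat n \<le> f i} \<inter> (I - {i \<in> I. enat (Suc n) \<le> f i}) \<subseteq> {i \<in> I. f i \<in> D}"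
      by blast
    ultimately show ?thesis
      by (rule ultrafilter_mono[OF H]) blast
  next
    case infinity
    then obtain n :: nat where n: "{enat n<..} \<subseteq> D"
      using D open_enat_iff by auto
    have "{i \<in> I. enat (Suc n) \<le> f i} \<in> \<H>" using y infinity by simp
    moreover have "{i \<in> I. enat (Suc n) \<le> f i} \<subseteq> {i \<in> I. f i \<in> D}"
    proof
      fix i assume "i \<in> {i \<in> I. enat (Suc n) \<le> f i}"
      then have "i \<in> I" "enat n < f i" by (auto simp: Suc_ile_eq)
      then show "i \<in> {i \<in> I. f i \<in> D}" using n by auto
    qed
    ultimately show ?thesis
      by (rule ultrafilter_mono[OF H]) blast
  qed
qed

lemma Hlim_eqI:
  assumes H: "ultrafilter_on I \<H>" and "has_Hlim I \<H> f y"
  shows "Hlim I \<H> f = y"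
  unfolding Hlim_def
proof (rule the_equality)
  fix z assume z: "has_Hlim I \<H> f z"
  show "z = y"
  proof (rule ccontr)
    assume "z \<noteq> y"
    then obtain U V where UV: "open U" "open V" "z \<in> U" "y \<in> V" "U \<inter> V = {}"
      using hausdorff by metis
    have "{i \<in> I. f i \<in> U} \<in> \<H>" "{i \<in> I. f i \<in> V} \<in> \<H>"
      using z assms(2) UV unfolding has_Hlim_def by blast+
    then have "{i \<in> I. f i \<in> U} \<inter> {i \<in> I. f i \<in> V} \<in> \<H>"
      by (rule ultrafilter_Int[OF H])
    moreover have "{i \<in> I. f i \<in> U} \<inter> {i \<in> I. f i \<in> V} = {}" using UV(5) by blast
    ultimately show False using H by (simp add: ultrafilter_on_def)
  qed
qed (rule assms(2))

lemma uf_lim_beta_nat: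
  assumes H: "ultrafilter_on I \<H>" and G: "\<forall>i\<in>I. \<G> i \<in> beta_nat"
  shows "uf_lim I \<H> \<G> \<in> beta_nat"
proof -
  have G: "ultrafilter_on {1..} (\<G> i)" if "i \<in> I" for i
    using G that by (simp add: beta_nat_def)
  have Hsub: "{i \<in> I. Q i} \<in> \<H>" if "S \<in> \<H>" "\<And>i. i \<in> S \<Longrightarrow> i \<in> I \<Longrightarrow> Q i" "S \<subseteq> I" for S Q
    using ultrafilter_mono[OF H that(1), of "{i \<in> I. Q i}"] that(2,3) by blast
  show ?thesis
    unfolding beta_nat_def ultrafilter_on_def uf_lim_def
  proof (intro CollectI conjI ballI allI impI)
    have I: "I \<in> \<H>" using H by (simp add: ultrafilter_on_def)
    have "{1..} \<in> \<G> i" if "i \<in> I" for i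
      using G[OF that] by (simp add: ultrafilter_on_def)
    then show "{i \<in> I. {1..} \<in> \<G> i} \<in> \<H>"
      by (intro Hsub[OF I]) auto
    have "{} \<notin> \<G> i" if "i \<in> I" for i
      using G[OF that] by (simp add: ultrafilter_on_def)
    then have eq: "{i \<in> I. {} \<in> \<G> i} = {}" by blast
    have "{} \<notin> \<H>" using H by (simp add: ultrafilter_on_def)
    then show "{} \<notin> {A. A \<subseteq> {1..} \<and> {i \<in> I. A \<in> \<G> i} \<in> \<H>}"
      unfolding mem_Collect_eq eq by blast
  next
    fix A B assume *: "A \<in> {A. A \<subseteq> {1..} \<and> {i \<in> I. A \<in> \<G> i} \<in> \<H>}" "B \<in> {A. A \<subseteq> {1..} \<and> {i \<in> I. A \<in> \<G> i} \<in> \<H>}"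
    then have AB: "{i \<in> I. A \<in> \<G> i} \<inter> {i \<in> I. B \<in> \<G> i} \<in> \<H>"
      using ultrafilter_Int[OF H] by blast
    show "{i \<in> I. A \<inter> B \<in> \<G> i} \<in> \<H>"
      by (rule Hsub[OF AB]) (auto intro: ultrafilter_Int[OF G])
    show "A \<inter> B \<subseteq> {1..}" using * by blast
  next
    fix A B assume *: "A \<in> {A. A \<subseteq> {1..} \<and> {i \<in> I. A \<in> \<G> i} \<in> \<H>}" "A \<subseteq> B \<and> B \<subseteq> {1..}"
    then have A: "{i \<in> I. A \<in> \<G> i} \<in> \<H>" by blast
    have "B \<in> \<G> i" if "i \<in> I" "A \<in> \<G> i" for i
      by (rule ultrafilter_mono[OF G[OF that(1)] that(2)]) (use * in blast)+
    then show "{i \<in> I. B \<in> \<G> i} \<in> \<H>"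
      by (intro Hsub[OF A]) auto
    show "B \<subseteq> {1..}" using * by blast
  next
    fix A :: "nat set" assume A: "A \<subseteq> {1..}"
    have "{i \<in> I. {1..} - A \<in> \<G> i} = I - {i \<in> I. A \<in> \<G> i}"
      using ultrafilter_compl[OF G A] by blast
    then have "{i \<in> I. {1..} - A \<in> \<G> i} \<in> \<H> \<longleftrightarrow> {i \<in> I. A \<in> \<G> i} \<notin> \<H>"
      using ultrafilter_compl[OF H, of "{i \<in> I. A \<in> \<G> i}"] by auto
    then show "A \<in> {A. A \<subseteq> {1..} \<and> {i \<in> I. A \<in> \<G> i} \<in> \<H>} \<or> {1..} - A \<in> {A. A \<subseteq> {1..} \<and> {i \<in> I. A \<in> \<G> i} \<in> \<H>}"
      using A by auto
  qed auto
qed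

theorem theorem3p7:
  fixes ext :: "('v, 'w) nsext" and h :: enat
    and I :: "'i set" and \<H> :: "'i set set" and \<G> :: "'i \<Rightarrow> nat set set"
    and \<F> :: "nat set set" and B :: "nat set set set"
  assumes "nonstandard_extension h ext" and "10 \<le> h"
    and "\<forall>i\<in>I. \<G> i \<in> beta_nat"
    and "ultrafilter_on I \<H>"
    and "\<F> = uf_lim I \<H> \<G>"
    and "B \<in> basic_classes ext"
  shows "is_minimum (uf_pattern ext \<F> B)
    {Hlim I \<H> (\<lambda>i. cardinal_sum ext (closure_classes ext A) (uf_pattern ext (\<G> i))) |A.
       A \<in> convex_sets \<and> in_class A B}"
proof -
  interpret nonstandard ext h
    by unfold_locales fact+
  have F: "\<F> \<in> beta_nat"
    using uf_lim_beta_nat assms(3-5) by blast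
  have lim: "Hlim I \<H> (\<lambda>i. cardinal_sum ext (closure_classes ext A) (uf_pattern ext (\<G> i))) = uf_count \<F> A"
    if A: "A \<in> convex_sets" for A
  proof (rule Hlim_eqI[OF assms(4)], rule has_Hlim_enatI[OF assms(4)])
    fix k
    \<comment> \<open>The set \<open>count_set A k\<close> does not depend on the index
      \<open>i\<close>, so its membership in the limit is decided by the definition of
      \<open>uf_lim\<close>.\<close>
    have "count_set A k \<subseteq> {1..}" by (auto simp: count_set_def)
    then have "count_set A k \<in> \<F> \<longleftrightarrow> {i \<in> I. count_set A k \<in> \<G> i} \<in> \<H>"
      unfolding assms(5) uf_lim_def by blast
    then have "{i \<in> I. count_set A k \<in> \<G> i} \<in> \<H> \<longleftrightarrow> enat k \<le> uf_count \<F> A"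
      using uf_count_iff[OF F] by simp
    moreover have "{i \<in> I. enat k \<le> cardinal_sum ext (closure_classes ext A) (uf_pattern ext (\<G> i))} =
        {i \<in> I. count_set A k \<in> \<G> i}"
      using cardinal_sum_closure[OF A] uf_count_iff assms(3) by auto
    ultimately show "{i \<in> I. enat k \<le> cardinal_sum ext (closure_classes ext A) (uf_pattern ext (\<G> i))} \<in> \<H> \<longleftrightarrow>
        enat k \<le> uf_count \<F> A"
      by simp
  qed
  \<comment> \<open>All candidates are now counts for the one ultrafilter \<F>, and
    \<open>uf_pattern_min\<close> applies to it.\<close>
  have "{Hlim I \<H> (\<lambda>i. cardinal_sum ext (closure_classes ext A) (uf_pattern ext (\<G> i))) |A.
       A \<in> convex_sets \<and> in_class A B} = uf_count \<F> ` class_sets B"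
    unfolding class_sets_def using lim by force
  then show ?thesis
    using uf_pattern_min(1)[OF assms(6) F] unfolding is_minimum_def by auto
qed

end
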